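(* Let $k,N\in\mathbb{N}$, let $\mathcal{F}$ be a nonempty collection of $k$-colourings of $E(K_N)$, and set $\mathcal{P}=\mathrm{Forb}(\mathcal{F})$; assume $\mathcal{P}_n\ne\emptyset$ for all $n$, and let $\pi(\mathcal{P})=\lim_{n\to\infty}\mathrm{ex}(n,\mathcal{P})/\binom n2$ (this limit exists). For all $\varepsilon>0$ there exists $n_0$ such that for all $n\ge n_0$, \[k^{\pi(\mathcal{P})\binom n2}\le|\mathcal{P}_n|\le k^{(\pi(\mathcal{P})+\varepsilon)\binom n2}.\]
   Context: $K_n$ is the complete graph on $[n]$; a $k$-colouring of $K_n$ is a map $E(K_n)\to[k]$. For $m\le n$, $\binom{K_n}{K_m}$ is the set of order-preserving injections $\phi:[m]\to[n]$; $c_{|\phi}(ij)=c(\phi(i)\phi(j))$. $\mathrm{Forb}(\mathcal{F})_n$ is the set of $k$-colourings $c$ of $K_n$ with $c_{|\phi}\notin\mathcal{F}$ for all $\phi\in\binom{K_n}{K_N}$. A template for $K_n$ is $t:E(K_n)\to2^{[k]}\setminus\{\emptyset\}$, $\langle t\rangle$ is the set of colourings $c$ with $c(e)\in t(e)$ for all $e$, $\mathrm{Ent}(t)=\sum_e\log_k|t(e)|$, and $\mathrm{ex}(n,\mathcal{P})=\max\{\mathrm{Ent}(t):\langle t\rangle\subseteq\mathcal{P}_n\}$. *)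

theory Defs
  imports Complex_Main "HOL-Library.FuncSet" "HOL-Library.Ramsey"
begin

definition edges :: "nat \<Rightarrow> nat set set" where
  "edges n = nsets {1..n} 2"

text \<open>Maps with domain \<open>E(K\<^sub>n)\<close> are extensional functions (value \<^const>\<open>undefined\<close> off \<^term>\<open>edges n\<close>),
  so equality of colourings is equality on the edges and the sets below are finite.\<close>

definition colourings :: "nat \<Rightarrow> nat \<Rightarrow> (nat set \<Rightarrow> nat) set" where
  "colourings k n = edges n \<rightarrow>\<^sub>E {1..k}"

definition order_embeddings :: "nat \<Rightarrow> nat \<Rightarrow> (nat \<Rightarrow> nat) set" where
  "order_embeddings m n = {\<phi> \<in> {1..m} \<rightarrow>\<^sub>E {1..n}. strict_mono_on {1..m} \<phi>}"

definition pullback :: "nat \<Rightarrow> (nat set \<Rightarrow> nat) \<Rightarrow> (nat \<Rightarrow> nat) \<Rightarrow> (nat set \<Rightarrow> nat)" where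
  "pullback m c \<phi> = (\<lambda>e\<in>edges m. c (\<phi> ` e))"

definition Forb :: "nat \<Rightarrow> nat \<Rightarrow> (nat set \<Rightarrow> nat) set \<Rightarrow> nat \<Rightarrow> (nat set \<Rightarrow> nat) set" where
  "Forb k N \<F> n = {c \<in> colourings k n. \<forall>\<phi>\<in>order_embeddings N n. pullback N c \<phi> \<notin> \<F>}"

definition templates :: "nat \<Rightarrow> nat \<Rightarrow> (nat set \<Rightarrow> nat set) set" where
  "templates k n = edges n \<rightarrow>\<^sub>E (Pow {1..k} - {{}})"

definition realisations :: "nat \<Rightarrow> nat \<Rightarrow> (nat set \<Rightarrow> nat set) \<Rightarrow> (nat set \<Rightarrow> nat) set" where
  "realisations k n t = {c \<in> colourings k n. \<forall>e\<in>edges n. c e \<in> t e}"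

definition Ent :: "nat \<Rightarrow> nat \<Rightarrow> (nat set \<Rightarrow> nat set) \<Rightarrow> real" where
  "Ent k n t = (\<Sum>e\<in>edges n. log (real k) (real (card (t e))))"

definition ex :: "nat \<Rightarrow> nat \<Rightarrow> (nat \<Rightarrow> (nat set \<Rightarrow> nat) set) \<Rightarrow> real" where
  "ex k n P = Max {Ent k n t | t. t \<in> templates k n \<and> realisations k n t \<subseteq> P n}"

definition ex_density :: "nat \<Rightarrow> (nat \<Rightarrow> (nat set \<Rightarrow> nat) set) \<Rightarrow> nat \<Rightarrow> real" where
  "ex_density k P n = ex k n P / real (n choose 2)"

definition entropy_density :: "nat \<Rightarrow> (nat \<Rightarrow> (nat set \<Rightarrow> nat) set) \<Rightarrow> real" where
  "entropy_density k P = lim (ex_density k P)"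

end

theory Submission imports Defs
begin

text \<open>Averaging over \<open>m\<close>-subsets of the vertices shows that \<open>ex(n,P) / (n choose 2)\<close> is
  nonincreasing, so it converges from above, and the realisations of an extremal template give
  the lower bound on \<open>|P\<^sub>n|\<close>.

  For the upper bound consider a uniformly random \<open>c \<in> P\<^sub>n\<close>, and reveal the colours of all edges
  meeting a vertex set \<open>W\<close>. The energy (mean square of the conditional colour probabilities of
  the edges) grows with \<open>W\<close> and is bounded, so some \<open>W\<close> of bounded size is saturated: revealing the
  edges at any \<open>N\<close> further vertices hardly changes the energy. All edges of a complete graph on
  vertex set \<open>S\<close> other than \<open>e\<close> meet \<open>S - e\<close>, so, given the revealed colours, each
  edge of a typical \<open>N\<close>-set is almost independent of its other edges. In the template of conditionally
  likely colours a forbidden pattern would then occur with positive probability wherever it is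
  allowed; hence this template has few forbidden patterns, and averaging over \<open>m\<close>-subsets again bounds
  its entropy by about \<open>\<pi>(P) (n choose 2)\<close>. Almost all colours of a typical
  colouring lie in its template, and only \<open>O(n)\<close> edges were revealed, which bounds \<open>|P\<^sub>n|\<close>.\<close>

subsection \<open>Conditional averages and energy\<close>

text \<open>An atom of the partition of \<open>A\<close> by the colours on \<open>T\<close>. For a
  uniformly random member of \<open>A\<close>, the next two definitions are conditional expectation
  and conditional probability given those colours.\<close>

definition fiber :: "('e \<Rightarrow> 'c) set \<Rightarrow> 'e set \<Rightarrow> ('e \<Rightarrow> 'c) \<Rightarrow> ('e \<Rightarrow> 'c) set" where
  "fiber A T c = {c' \<in> A. \<forall>e\<in>T. c' e = c e}"

definition cavg :: "('e \<Rightarrow> 'c) set \<Rightarrow> 'e set \<Rightarrow> (('e \<Rightarrow> 'c) \<Rightarrow> real) \<Rightarrow> ('e \<Rightarrow> 'c) \<Rightarrow> real" where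
  "cavg A T f c = (\<Sum>c'\<in>fiber A T c. f c') / real (card (fiber A T c))"

definition cprob :: "('e \<Rightarrow> 'c) set \<Rightarrow> 'e set \<Rightarrow> 'e \<Rightarrow> 'c \<Rightarrow> ('e \<Rightarrow> 'c) \<Rightarrow> real" where
  "cprob A T e a = cavg A T (\<lambda>c. of_bool (c e = a))"

text \<open>Left unnormalised: dividing by \<open>card A\<close> gives the expected sum of squared
  conditional probabilities.\<close>

definition energy :: "('e \<Rightarrow> 'c) set \<Rightarrow> 'c set \<Rightarrow> 'e set \<Rightarrow> 'e \<Rightarrow> real" where
  "energy A K T e = (\<Sum>c\<in>A. \<Sum>a\<in>K. (cprob A T e a c)\<^sup>2)"

lemma fiber_subset: "fiber A T c \<subseteq> A"
  by (auto simp: fiber_def)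

lemma finite_fiber: "finite A \<Longrightarrow> finite (fiber A T c)"
  by (simp add: fiber_def)

lemma self_in_fiber: "c \<in> A \<Longrightarrow> c \<in> fiber A T c"
  by (simp add: fiber_def)

lemma card_fiber_pos: "finite A \<Longrightarrow> c \<in> A \<Longrightarrow> 0 < card (fiber A T c)"
  using self_in_fiber finite_fiber by (metis card_gt_0_iff empty_iff)

lemma fiber_cong: "(\<And>e. e \<in> T \<Longrightarrow> c e = c' e) \<Longrightarrow> fiber A T c = fiber A T c'"
  by (auto simp: fiber_def)

lemma fiber_eq: "c' \<in> fiber A T c \<Longrightarrow> fiber A T c' = fiber A T c"
  by (rule fiber_cong) (simp add: fiber_def)

lemma cavg_fiber: "c' \<in> fiber A T c \<Longrightarrow> cavg A T f c' = cavg A T f c"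
  by (simp add: cavg_def fiber_eq)

lemma cprob_fiber: "c' \<in> fiber A T c \<Longrightarrow> cprob A T e a c' = cprob A T e a c"
  by (simp add: cprob_def cavg_fiber)

lemma cprob_eq_card:
  assumes "finite A"
  shows "cprob A T e a c = real (card {c' \<in> fiber A T c. c' e = a}) / real (card (fiber A T c))"
  using finite_fiber[OF assms] by (simp add: cprob_def cavg_def Int_def)

lemma cprob_nonneg: "finite A \<Longrightarrow> 0 \<le> cprob A T e a c"
  by (simp add: cprob_eq_card)

lemma cprob_le_1: "finite A \<Longrightarrow> cprob A T e a c \<le> 1"
  by (auto simp: cprob_eq_card divide_le_eq intro!: card_mono finite_fiber)

text \<open>The defining property of conditional expectation: a factor \<open>h\<close> that is
  constant on fibers passes through the averaging. Lying in a common fiber is an equivalence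
  relation, so after swapping the double sum each \<open>c\<close> is counted once per member of its
  fiber, with weight one over the fiber size.\<close>

lemma sum_cavg:
  assumes fin: "finite A"
    and meas: "\<And>c c'. c \<in> A \<Longrightarrow> c' \<in> fiber A T c \<Longrightarrow> h c' = h c"
  shows "(\<Sum>c\<in>A. h c * cavg A T f c) = (\<Sum>c\<in>A. h c * f c)"
proof -
  have "(\<Sum>c\<in>A. h c * cavg A T f c)
      = (\<Sum>c\<in>A. \<Sum>c'\<in>{c'\<in>A. \<forall>e\<in>T. c' e = c e}. h c * f c' / card (fiber A T c))"
    by (simp add: cavg_def sum_divide_distrib sum_distrib_left fiber_def)
  also have "\<dots> = (\<Sum>c'\<in>A. \<Sum>c\<in>{c\<in>A. \<forall>e\<in>T. c' e = c e}. h c * f c' / card (fiber A T c))"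
    using fin by (intro sum.swap_restrict) auto
  also have "\<dots> = (\<Sum>c'\<in>A. \<Sum>c\<in>fiber A T c'. h c' * f c' / card (fiber A T c'))"
  proof (intro sum.cong refl)
    fix c' c assume "c' \<in> A" and c: "c \<in> fiber A T c'"
    then show "h c * f c' / card (fiber A T c) = h c' * f c' / card (fiber A T c')"
      using meas fiber_eq[OF c] by simp
  qed (auto simp: fiber_def)
  also have "\<dots> = (\<Sum>c\<in>A. h c * f c)"
    using card_fiber_pos[OF fin] by (intro sum.cong) auto
  finally show ?thesis .
qed

lemma sum_cavg_1:
  assumes "finite A"
  shows "(\<Sum>c\<in>A. cavg A T f c) = (\<Sum>c\<in>A. f c)"
  using sum_cavg[OF assms, of T "\<lambda>_. 1" f] by simp

lemma fiber_antimono: "T \<subseteq> T' \<Longrightarrow> fiber A T' c \<subseteq> fiber A T c"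
  by (auto simp: fiber_def)

text \<open>Pythagoras: conditioning on the smaller \<open>T\<close> is an orthogonal projection of
  conditioning on \<open>T'\<close>, so the difference of squared norms is the squared norm of the
  difference.\<close>

lemma energy_increment:
  assumes fin: "finite A" and sub: "T \<subseteq> T'"
  shows "energy A K T' e - energy A K T e
    = (\<Sum>c\<in>A. \<Sum>a\<in>K. (cprob A T' e a c - cprob A T e a c)\<^sup>2)"
proof -
  have *: "(\<Sum>c\<in>A. (cprob A T' e a c)\<^sup>2) - (\<Sum>c\<in>A. (cprob A T e a c)\<^sup>2)
      = (\<Sum>c\<in>A. (cprob A T' e a c - cprob A T e a c)\<^sup>2)" for a
  proof -
    \<comment> \<open>Both inner products equal the one with the indicator of
      \<open>c e = a\<close>, because \<open>cprob A T e a\<close> is constant on the fibers of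
      \<open>T\<close> and hence on those of \<open>T'\<close>.\<close>
    have "(\<Sum>c\<in>A. cprob A T e a c * cprob A T' e a c) = (\<Sum>c\<in>A. cprob A T e a c * of_bool (c e = a))"
      unfolding cprob_def[of A T']
      by (rule sum_cavg[OF fin]) (meson cprob_fiber fiber_antimono[OF sub] subsetD)
    also have "\<dots> = (\<Sum>c\<in>A. cprob A T e a c * cprob A T e a c)"
      unfolding cprob_def[of A T]
      by (rule sum_cavg[OF fin, symmetric]) (rule cavg_fiber)
    finally have cross: "(\<Sum>c\<in>A. cprob A T e a c * cprob A T' e a c) = (\<Sum>c\<in>A. (cprob A T e a c)\<^sup>2)"
      by (simp add: power2_eq_square)
    have "(\<Sum>c\<in>A. (cprob A T' e a c - cprob A T e a c)\<^sup>2)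
       = (\<Sum>c\<in>A. (cprob A T' e a c)\<^sup>2) + (\<Sum>c\<in>A. (cprob A T e a c)\<^sup>2)
         - 2 * (\<Sum>c\<in>A. cprob A T e a c * cprob A T' e a c)"
      by (simp add: power2_diff sum.distrib sum_subtractf sum_distrib_left mult_ac)
    with cross show ?thesis by simp
  qed
  show ?thesis
    unfolding energy_def sum.swap[of _ K A]
    by (simp only: * flip: sum_subtractf[where A = K])
qed

lemma energy_mono:
  assumes "finite A" "T \<subseteq> T'"
  shows "energy A K T e \<le> energy A K T' e"
proof -
  have "0 \<le> energy A K T' e - energy A K T e"
    unfolding energy_increment[OF assms] by (intro sum_nonneg) simp
  then show ?thesis by simp
qed

lemma energy_nonneg: "0 \<le> energy A K T e"
  by (simp add: energy_def sum_nonneg)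

lemma energy_le:
  assumes "finite A"
  shows "energy A K T e \<le> real (card A) * real (card K)"
proof -
  have "(cprob A T e a c)\<^sup>2 \<le> 1" for a c
    using cprob_nonneg[OF assms] cprob_le_1[OF assms] by (simp add: power_le_one)
  then have "energy A K T e \<le> (\<Sum>c\<in>A. \<Sum>a\<in>K. 1)"
    unfolding energy_def by (intro sum_mono) auto
  then show ?thesis by simp
qed

text \<open>A chain rule: the edges of \<open>D\<close> are prescribed one at a time. Given the
  edges already prescribed, the colour \<open>F e\<close> still has conditional probability at least
  \<open>\<eta>\<close>, up to the deviation caused by revealing \<open>T' e\<close>.
  \<open>T' e\<close> may exceed \<open>T \<union> (E - {e})\<close>, since later whole stars are
  revealed.\<close>

lemma pattern_count_ge:
  assumes fin: "finite A" and eta: "0 \<le> \<eta>" "\<eta> \<le> 1"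
    and D: "finite D" "D \<subseteq> E"
    and likely: "\<And>e. e \<in> E \<Longrightarrow> \<eta> \<le> cprob A T e (F e) c0"
    and T': "\<And>e. e \<in> E \<Longrightarrow> T \<union> (E - {e}) \<subseteq> T' e"
  shows "\<eta> ^ card D * card (fiber A T c0)
      - (\<Sum>e\<in>D. \<Sum>c\<in>fiber A T c0. \<bar>cprob A (T' e) e (F e) c - cprob A T e (F e) c\<bar>)
    \<le> card {c \<in> fiber A T c0. \<forall>e\<in>D. c e = F e}"
  using D
proof (induction D rule: finite_induct)
  case empty
  then show ?case by simp
next
  case (insert e D)
  let ?B = "fiber A T c0"
  let ?G = "{c \<in> ?B. \<forall>e\<in>D. c e = F e}"
  define dev where "dev = (\<lambda>e. \<Sum>c\<in>?B. \<bar>cprob A (T' e) e (F e) c - cprob A T e (F e) c\<bar>)"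
  have finB: "finite ?B" using fin by (rule finite_fiber)
  have GA: "?G \<subseteq> A" using fiber_subset by blast
  have eE: "e \<in> E" and DE: "D \<subseteq> E" using insert by auto
  have dev0: "0 \<le> dev e'" for e' by (simp add: dev_def sum_nonneg)
  have IH: "\<eta> ^ card D * card ?B - (\<Sum>e\<in>D. dev e) \<le> card ?G"
    using insert.IH DE by (simp add: dev_def)
  have "real (card {c \<in> ?B. \<forall>e\<in>insert e D. c e = F e}) = (\<Sum>c\<in>A. of_bool (c \<in> ?G) * of_bool (c e = F e))"
  proof -
    have "(\<Sum>c\<in>A. of_bool (c \<in> ?G) * of_bool (c e = F e) :: real)
        = (\<Sum>c\<in>A. of_bool (c \<in> {c \<in> ?B. \<forall>e\<in>insert e D. c e = F e}))"
      by (intro sum.cong) auto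
    also have "\<dots> = card (A \<inter> {c \<in> ?B. \<forall>e\<in>insert e D. c e = F e})"
      using fin by (simp add: Int_def)
    also have "A \<inter> {c \<in> ?B. \<forall>e\<in>insert e D. c e = F e} = {c \<in> ?B. \<forall>e\<in>insert e D. c e = F e}"
      using fiber_subset by blast
    finally show ?thesis by simp
  qed
  \<comment> \<open>Membership in \<open>?G\<close> depends only on the colours on
    \<open>T \<union> D\<close>, which lies in \<open>T' e\<close> as \<open>e\<close> is not in
    \<open>D\<close>; so the indicator of \<open>c e = F e\<close> can be replaced by its
    conditional probability.\<close>
  also have "\<dots> = (\<Sum>c\<in>A. of_bool (c \<in> ?G) * cprob A (T' e) e (F e) c)"
    unfolding cprob_def
  proof (rule sum_cavg[OF fin, symmetric])
    fix c c' assume c: "c \<in> A" and c': "c' \<in> fiber A (T' e) c"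
    have "c' e' = c e'" if "e' \<in> T \<union> D" for e'
      using c' that T'[OF eE] DE insert.hyps by (auto simp: fiber_def)
    then show "of_bool (c' \<in> ?G) = (of_bool (c \<in> ?G) :: real)"
      using c c' by (auto simp: fiber_def)
  qed
  also have "\<dots> = (\<Sum>c\<in>?G. cprob A (T' e) e (F e) c)"
    using fin GA by (simp add: of_bool_def if_distrib[of "\<lambda>x. x * _"] sum.If_cases Int_absorb1 cong: if_cong)
  also have "\<dots> \<ge> (\<Sum>c\<in>?G. \<eta> - \<bar>cprob A (T' e) e (F e) c - cprob A T e (F e) c\<bar>)"
  proof (rule sum_mono)
    fix c assume "c \<in> ?G"
    then have "cprob A T e (F e) c = cprob A T e (F e) c0" by (auto intro: cprob_fiber)
    then show "\<eta> - \<bar>cprob A (T' e) e (F e) c - cprob A T e (F e) c\<bar> \<le> cprob A (T' e) e (F e) c"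
      using likely[OF eE] by linarith
  qed
  also have "(\<Sum>c\<in>?G. \<eta> - \<bar>cprob A (T' e) e (F e) c - cprob A T e (F e) c\<bar>)
      = \<eta> * card ?G - (\<Sum>c\<in>?G. \<bar>cprob A (T' e) e (F e) c - cprob A T e (F e) c\<bar>)"
    by (simp add: sum_subtractf mult.commute)
  finally have "\<eta> * card ?G - (\<Sum>c\<in>?G. \<bar>cprob A (T' e) e (F e) c - cprob A T e (F e) c\<bar>)
      \<le> card {c \<in> ?B. \<forall>e\<in>insert e D. c e = F e}" .
  moreover have "(\<Sum>c\<in>?G. \<bar>cprob A (T' e) e (F e) c - cprob A T e (F e) c\<bar>) \<le> dev e"
    unfolding dev_def using finB by (intro sum_mono2) auto
  moreover have "\<eta> * (\<eta> ^ card D * card ?B - (\<Sum>e\<in>D. dev e)) \<le> \<eta> * card ?G"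
    using IH eta(1) by (rule mult_left_mono)
  \<comment> \<open>The earlier losses are only multiplied by \<open>\<eta> \<le> 1\<close>, so the
    losses simply add up.\<close>
  moreover have "\<eta> * (\<Sum>e\<in>D. dev e) \<le> (\<Sum>e\<in>D. dev e)"
    using eta dev0 by (simp add: mult_left_le_one_le sum_nonneg)
  moreover have "\<eta> * (\<eta> ^ card D * card ?B - (\<Sum>e\<in>D. dev e))
      = \<eta> ^ card (insert e D) * card ?B - \<eta> * (\<Sum>e\<in>D. dev e)"
    using insert.hyps by (simp add: right_diff_distrib)
  ultimately have "\<eta> ^ card (insert e D) * card ?B - (dev e + (\<Sum>e\<in>D. dev e))
      \<le> card {c \<in> ?B. \<forall>e\<in>insert e D. c e = F e}"
    by linarith
  then show ?case
    unfolding sum.insert[OF insert.hyps] dev_def .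
qed

text \<open>With no colouring showing \<open>F\<close>, the count in \<open>pattern_count_ge\<close>
  is 0, so the deviations must total at least \<open>\<eta> ^ card E\<close> times the fiber size.
  Passing to squares gives a lower bound on the local energy gain.\<close>

lemma missing_pattern_deviation:
  assumes fin: "finite A" and c0: "c0 \<in> A" and eta: "0 \<le> \<eta>" "\<eta> \<le> 1"
    and E: "finite E" "E \<noteq> {}"
    and likely: "\<And>e. e \<in> E \<Longrightarrow> \<eta> \<le> cprob A T e (F e) c0"
    and T': "\<And>e. e \<in> E \<Longrightarrow> T \<union> (E - {e}) \<subseteq> T' e"
    and missing: "\<not> (\<exists>c\<in>A. \<forall>e\<in>E. c e = F e)"
    and K: "finite K" "F ` E \<subseteq> K"
  shows "\<eta> ^ (2 * card E) / card E
    \<le> cavg A T (\<lambda>c. \<Sum>e\<in>E. \<Sum>a\<in>K. (cprob A (T' e) e a c - cprob A T e a c)\<^sup>2) c0"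
proof -
  let ?B = "fiber A T c0"
  define x where "x = (\<lambda>e c. \<bar>cprob A (T' e) e (F e) c - cprob A T e (F e) c\<bar>)"
  define r where "r = real (card E)"
  \<comment> \<open>The lower bound that \<open>dev\<close> gives for the mean of \<open>x\<close>
    over all pairs of an edge and a colouring; it maximises the quadratic bound used below.\<close>
  define s where "s = \<eta> ^ card E / r"
  have r: "0 < r" using E by (simp add: r_def card_gt_0_iff)
  have s: "0 \<le> s" using r eta by (simp add: s_def)
  have B: "0 < card ?B" using fin c0 by (rule card_fiber_pos)
  have none: "{c \<in> ?B. \<forall>e\<in>E. c e = F e} = {}"
    using missing fiber_subset by blast
  have dev: "\<eta> ^ card E * card ?B \<le> (\<Sum>e\<in>E. \<Sum>c\<in>?B. x e c)"
    using pattern_count_ge[OF fin eta E(1) subset_refl likely T']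
    unfolding none x_def by simp
  \<comment> \<open>Cauchy--Schwarz in the form \<open>2 s x - s\<^sup>2 \<le> x\<^sup>2\<close>\<close>
  have "s * \<eta> ^ card E * card ?B = 2 * s * (\<eta> ^ card E * card ?B) - s\<^sup>2 * r * card ?B"
    using r by (simp add: s_def power2_eq_square field_simps)
  also have "\<dots> \<le> 2 * s * (\<Sum>e\<in>E. \<Sum>c\<in>?B. x e c) - s\<^sup>2 * r * card ?B"
    using dev s by (intro diff_right_mono mult_left_mono) auto
  also have "\<dots> = (\<Sum>e\<in>E. \<Sum>c\<in>?B. 2 * s * x e c - s\<^sup>2)"
    by (simp add: sum_subtractf sum_distrib_left r_def mult_ac)
  also have "\<dots> \<le> (\<Sum>e\<in>E. \<Sum>c\<in>?B. (x e c)\<^sup>2)"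
  proof (intro sum_mono)
    fix e c
    show "2 * s * x e c - s\<^sup>2 \<le> (x e c)\<^sup>2"
      using zero_le_power2[of "x e c - s"] by (simp add: power2_diff mult_ac)
  qed
  also have "\<dots> \<le> (\<Sum>e\<in>E. \<Sum>c\<in>?B. \<Sum>a\<in>K. (cprob A (T' e) e a c - cprob A T e a c)\<^sup>2)"
  proof (intro sum_mono)
    fix e c assume "e \<in> E" "c \<in> ?B"
    then show "(x e c)\<^sup>2 \<le> (\<Sum>a\<in>K. (cprob A (T' e) e a c - cprob A T e a c)\<^sup>2)"
      using K member_le_sum[of "F e" K "\<lambda>a. (cprob A (T' e) e a c - cprob A T e a c)\<^sup>2"]
      by (auto simp: x_def)
  qed
  also have "\<dots> = (\<Sum>c\<in>?B. \<Sum>e\<in>E. \<Sum>a\<in>K. (cprob A (T' e) e a c - cprob A T e a c)\<^sup>2)"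
    by (rule sum.swap)
  finally have "s * \<eta> ^ card E
      \<le> cavg A T (\<lambda>c. \<Sum>e\<in>E. \<Sum>a\<in>K. (cprob A (T' e) e a c - cprob A T e a c)\<^sup>2) c0"
    using B by (simp add: cavg_def le_divide_eq)
  then show ?thesis
    by (simp add: s_def r_def mult_2 power_add)
qed

text \<open>Energy increment: if no set were saturated, adding at most \<open>r\<close> points could
  be repeated \<open>L + 1\<close> times, each time gaining more than \<open>d\<close>, and would
  exceed \<open>b\<close>.\<close>

lemma ex_saturated_subset:
  fixes \<Phi> :: "'v set \<Rightarrow> real"
  assumes bound: "\<And>W. 0 \<le> \<Phi> W" "\<And>W. \<Phi> W \<le> b"
    and d: "0 < d" and L: "b \<le> real L * d"
  shows "\<exists>W. finite W \<and> card W \<le> L * r \<and>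
    (\<forall>R. finite R \<longrightarrow> card R \<le> r \<longrightarrow> \<Phi> (W \<union> R) \<le> \<Phi> W + d)"
proof (rule ccontr)
  assume none: "\<not> ?thesis"
  \<comment> \<open>Stopping at \<open>Suc L\<close> means that every set being enlarged still has
    at most \<open>L * r\<close> points, so it is a candidate excluded by
    \<open>none\<close>.\<close>
  have "\<exists>W. finite W \<and> card W \<le> l * r \<and> l * d \<le> \<Phi> W" if "l \<le> Suc L" for l
    using that
  proof (induction l)
    case 0
    then show ?case using bound by (intro exI[of _ "{}"]) auto
  next
    case (Suc l)
    then obtain W where W: "finite W" "card W \<le> l * r" "l * d \<le> \<Phi> W" by auto
    have "card W \<le> L * r"
      using W(2) Suc.prems by (meson Suc_le_mono le_trans mult_le_mono1)
    then obtain R where R: "finite R" "card R \<le> r" "\<Phi> W + d < \<Phi> (W \<union> R)"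
      using none W(1) by (meson not_le)
    have "card (W \<union> R) \<le> Suc l * r"
      using card_Un_le[of W R] W(2) R(2) by simp
    moreover have "Suc l * d \<le> \<Phi> (W \<union> R)"
      using W(3) R(3) by (simp add: algebra_simps)
    ultimately show ?case
      using W(1) R(1) by (intro exI[of _ "W \<union> R"]) auto
  qed
  from this[of "Suc L"] obtain W where "Suc L * d \<le> \<Phi> W" by auto
  with bound(2)[of W] L d show False by (simp add: algebra_simps)
qed

subsection \<open>Counting colourings by likely colours\<close>

text \<open>Gibbs' inequality against the product weights that are \<open>1\<close> on \<open>t e\<close> and \<open>\<rho>\<close> off it;
  the convexity used is \<open>exp x \<ge> exp \<mu> * (1 + x - \<mu>)\<close> with \<open>\<mu>\<close> the mean exponent.\<close>

lemma ln_card_le_likely_template: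
  fixes B :: "('e \<Rightarrow> 'c) set" and t :: "'e \<Rightarrow> 'c set" and \<eta> \<rho> :: real
  assumes fin: "finite E" "finite K" and B: "B \<subseteq> E \<rightarrow>\<^sub>E K" "B \<noteq> {}"
    and t: "\<And>e. e \<in> E \<Longrightarrow> t e \<subseteq> K" "\<And>e. e \<in> E \<Longrightarrow> t e \<noteq> {}"
    and lam: "0 < \<rho>" "\<rho> \<le> 1"
    and rare: "\<And>e a. e \<in> E \<Longrightarrow> a \<in> K - t e \<Longrightarrow> real (card {c \<in> B. c e = a}) \<le> \<eta> * card B"
    and eta: "0 \<le> \<eta>"
  shows "ln (card B) \<le> (\<Sum>e\<in>E. ln (card (t e))) + card E * (\<rho> * card K + card K * \<eta> * ln (1 / \<rho>))"
proof -
  define w where "w = (\<lambda>e a. if a \<in> t e then 1 else \<rho>)"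
  define x where "x = (\<lambda>c. \<Sum>e\<in>E. ln (w e (c e)))"
  define b where "b = real (card B)"
  define \<mu> where "\<mu> = (\<Sum>c\<in>B. x c) / b"
  have finB: "finite B" using B(1) fin by (meson finite_PiE finite_subset)
  have b: "0 < b" using finB B(2) by (simp add: b_def card_gt_0_iff)
  have w: "0 < w e a" for e a using lam by (simp add: w_def)
  have fint: "finite (t e)" if "e \<in> E" for e using t(1)[OF that] fin(2) by (rule finite_subset)
  have cpos: "0 < real (card (t e))" if "e \<in> E" for e
    using fint t(2) that by (simp add: card_gt_0_iff)
  have pos: "0 < 1 + \<rho> * card K" using lam by (simp add: add_pos_nonneg)
  have expx: "exp (x c) = (\<Prod>e\<in>E. w e (c e))" for c
    using fin w by (simp add: x_def exp_sum)
  have "b * exp \<mu> = (\<Sum>c\<in>B. exp \<mu> * (1 + (x c - \<mu>)))"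
    using b by (simp add: sum_distrib_left[symmetric] sum.distrib sum_subtractf \<mu>_def b_def[symmetric])
  also have "\<dots> \<le> (\<Sum>c\<in>B. exp \<mu> * exp (x c - \<mu>))"
    by (intro sum_mono mult_left_mono exp_ge_add_one_self) auto
  also have "\<dots> = (\<Sum>c\<in>B. \<Prod>e\<in>E. w e (c e))"
    by (simp add: expx flip: exp_add)
  \<comment> \<open>Enlarging the sum to all maps makes it factor over the edges.\<close>
  also have "\<dots> \<le> (\<Sum>c\<in>E \<rightarrow>\<^sub>E K. \<Prod>e\<in>E. w e (c e))"
    using B fin w by (intro sum_mono2 finite_PiE prod_nonneg) (auto simp: less_imp_le)
  also have "\<dots> = (\<Prod>e\<in>E. \<Sum>a\<in>K. w e a)"
    using fin by (intro prod_sum_PiE[symmetric]) auto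
  also have "\<dots> \<le> (\<Prod>e\<in>E. card (t e) * (1 + \<rho> * card K))"
  proof (intro prod_mono conjI sum_nonneg)
    fix e assume e: "e \<in> E"
    have "(\<Sum>a\<in>K. w e a) \<le> (\<Sum>a\<in>K. of_bool (a \<in> t e) + \<rho>)"
      using lam by (intro sum_mono) (auto simp: w_def)
    also have "\<dots> = card (t e) + \<rho> * card K"
      using fin t(1)[OF e] by (simp add: sum.distrib Int_absorb1)
    \<comment> \<open>Uses \<open>card (t e) \<ge> 1\<close>, which pulls the error out as a factor
      common to all edges.\<close>
    also have "\<dots> \<le> card (t e) + card (t e) * (\<rho> * card K)"
      using cpos[OF e] lam mult_right_mono[of 1 "real (card (t e))" "\<rho> * card K"] by simp
    finally show "(\<Sum>a\<in>K. w e a) \<le> card (t e) * (1 + \<rho> * card K)"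
      by (simp add: distrib_left)
  qed (use w in \<open>auto simp: less_imp_le\<close>)
  finally have "b * exp \<mu> \<le> (\<Prod>e\<in>E. card (t e) * (1 + \<rho> * card K))" .
  moreover have "0 < b * exp \<mu>" using b by simp
  ultimately have "ln (b * exp \<mu>) \<le> ln (\<Prod>e\<in>E. card (t e) * (1 + \<rho> * card K))"
    by (meson ln_le_cancel_iff less_le_trans)
  also have "\<dots> = (\<Sum>e\<in>E. ln (card (t e) * (1 + \<rho> * card K)))"
    using fin cpos pos by (intro ln_prod) auto
  also have "\<dots> = (\<Sum>e\<in>E. ln (card (t e)) + ln (1 + \<rho> * card K))"
    using cpos pos by (intro sum.cong refl ln_mult_pos) auto
  also have "\<dots> \<le> (\<Sum>e\<in>E. ln (card (t e)) + \<rho> * card K)"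
    using lam by (intro sum_mono add_left_mono ln_add_one_self_le_self) auto
  finally have upper: "ln b + \<mu> \<le> (\<Sum>e\<in>E. ln (card (t e))) + card E * (\<rho> * card K)"
    using b by (simp add: ln_mult_pos sum.distrib)
  \<comment> \<open>\<open>x c\<close> is \<open>ln \<rho>\<close> times the number of edges that
    \<open>c\<close> colours off the template, and each edge is coloured so by at most
    \<open>card K * \<eta> * b\<close> members of \<open>B\<close>. Since
    \<open>ln \<rho> \<le> 0\<close>, this bounds the sum from below.\<close>
  have "card E * (card K * \<eta> * ln \<rho>) * b \<le> (\<Sum>c\<in>B. x c)"
  proof -
    have "(\<Sum>c\<in>B. x c) = (\<Sum>e\<in>E. \<Sum>c\<in>B. ln (w e (c e)))"
      unfolding x_def by (rule sum.swap)
    also have "\<dots> \<ge> (\<Sum>e\<in>E. card K * \<eta> * b * ln \<rho>)"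
    proof (intro sum_mono)
      fix e assume e: "e \<in> E"
      have "(\<Sum>c\<in>B. of_bool (c e \<notin> t e)) \<le> (\<Sum>c\<in>B. \<Sum>a\<in>K - t e. of_bool (c e = a) :: real)"
      proof (intro sum_mono)
        fix c assume "c \<in> B"
        then have "c e \<in> K" using B e by (auto simp: PiE_def)
        then show "of_bool (c e \<notin> t e) \<le> (\<Sum>a\<in>K - t e. of_bool (c e = a) :: real)"
          using fin member_le_sum[of "c e" "K - t e" "\<lambda>a. of_bool (c e = a) :: real"]
          by (auto simp: sum_nonneg)
      qed
      also have "\<dots> = (\<Sum>a\<in>K - t e. \<Sum>c\<in>B. of_bool (c e = a))"
        by (rule sum.swap)
      also have "\<dots> \<le> (\<Sum>a\<in>K - t e. \<eta> * b)"
        using rare[OF e] finB by (intro sum_mono) (simp add: b_def Int_def)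
      also have "\<dots> \<le> card K * (\<eta> * b)"
        using eta b fin by (auto intro!: mult_right_mono card_mono)
      finally have "(\<Sum>c\<in>B. of_bool (c e \<notin> t e)) * ln \<rho> \<ge> card K * (\<eta> * b) * ln \<rho>"
        using lam by (intro mult_right_mono_neg) auto
      also have "(\<Sum>c\<in>B. of_bool (c e \<notin> t e)) * ln \<rho> = (\<Sum>c\<in>B. ln (w e (c e)))"
        unfolding sum_distrib_right by (intro sum.cong) (auto simp: w_def)
      finally show "card K * \<eta> * b * ln \<rho> \<le> (\<Sum>c\<in>B. ln (w e (c e)))"
        by (simp add: mult_ac)
    qed
    finally show ?thesis by (simp add: mult_ac)
  qed
  then have "card E * (card K * \<eta> * ln \<rho>) \<le> \<mu>"
    using b by (simp add: \<mu>_def le_divide_eq)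
  then show ?thesis
    using upper lam by (simp add: ln_div b_def algebra_simps)
qed

subsection \<open>Templates and supersaturation\<close>

lemma finite_edges [simp]: "finite (edges n)"
  by (simp add: edges_def finite_imp_finite_nsets)

lemma card_edges [simp]: "card (edges n) = n choose 2"
  by (simp add: edges_def)

lemma finite_colourings: "finite (colourings k n)"
  by (simp add: colourings_def finite_PiE)

lemma finite_templates: "finite (templates k n)"
  by (simp add: templates_def finite_PiE)

lemma Ent_le_ex:
  assumes "t \<in> templates k n" "realisations k n t \<subseteq> P n"
  shows "Ent k n t \<le> ex k n P"
  unfolding ex_def using assms finite_templates[of k n]
  by (intro Max_ge) auto

text \<open>The maximum is over a nonempty set: a colouring in \<open>P n\<close>, read as a
  template of singletons, has no realisation other than itself.\<close>

lemma ex_attained: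
  assumes "P n \<noteq> {}" "P n \<subseteq> colourings k n"
  obtains t where "t \<in> templates k n" "realisations k n t \<subseteq> P n" "Ent k n t = ex k n P"
proof -
  obtain c where c: "c \<in> P n" "c \<in> colourings k n" using assms by blast
  define t where "t = (\<lambda>e\<in>edges n. {c e})"
  have "t \<in> templates k n"
    using c(2) by (auto simp: t_def templates_def colourings_def PiE_def Pi_def)
  moreover have "realisations k n t \<subseteq> {c}"
  proof
    fix c' assume "c' \<in> realisations k n t"
    then have "c' \<in> extensional (edges n)" "\<And>e. e \<in> edges n \<Longrightarrow> c' e = c e"
      by (auto simp: realisations_def t_def colourings_def PiE_def)
    then show "c' \<in> {c}"
      using c(2) by (auto simp: colourings_def PiE_def intro!: extensionalityI)
  qed
  ultimately have "{Ent k n t | t. t \<in> templates k n \<and> realisations k n t \<subseteq> P n} \<noteq> {}"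
    using c by blast
  moreover have "finite {Ent k n t | t. t \<in> templates k n \<and> realisations k n t \<subseteq> P n}"
    using finite_templates[of k n] by auto
  ultimately have "ex k n P \<in> {Ent k n t | t. t \<in> templates k n \<and> realisations k n t \<subseteq> P n}"
    unfolding ex_def by (rule Max_in[rotated])
  then show ?thesis using that by auto
qed

lemma template_card:
  assumes "t \<in> templates k n" "e \<in> edges n"
  shows "0 < card (t e)" "card (t e) \<le> k"
proof -
  have "t e \<noteq> {}" "t e \<subseteq> {1..k}" using assms by (auto simp: templates_def)
  then show "0 < card (t e)" "card (t e) \<le> k"
    using card_mono[of "{1..k}" "t e"] finite_subset[of "t e" "{1..k}"] by (auto simp: card_gt_0_iff)
qed

lemma log_card_template:
  assumes "2 \<le> k" "t \<in> templates k n" "e \<in> edges n"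
  shows "0 \<le> log k (card (t e))" "log k (card (t e)) \<le> 1"
  using template_card[OF assms(2,3)] assms(1) by (auto simp: zero_le_log_cancel_iff log_le_one_cancel_iff)

lemma Ent_nonneg:
  assumes "2 \<le> k" "t \<in> templates k n"
  shows "0 \<le> Ent k n t"
  unfolding Ent_def using log_card_template[OF assms] by (intro sum_nonneg) auto

lemma card_realisations:
  assumes k: "2 \<le> k" and t: "t \<in> templates k n"
  shows "card (realisations k n t) = k powr Ent k n t"
proof -
  have "t e \<subseteq> {1..k}" if "e \<in> edges n" for e using t that by (auto simp: templates_def)
  then have "realisations k n t = PiE (edges n) t"
    unfolding realisations_def colourings_def PiE_def Pi_def by blast
  then have "real (card (realisations k n t)) = (\<Prod>e\<in>edges n. real (card (t e)))"
    by (simp add: card_PiE)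
  also have "\<dots> = (\<Prod>e\<in>edges n. k powr log k (card (t e)))"
    using template_card[OF t] k by (intro prod.cong refl) simp
  also have "\<dots> = k powr Ent k n t"
    using k by (simp add: Ent_def powr_sum)
  finally show ?thesis .
qed

section \<open>Order embeddings and vertex sets carrying forbidden patterns\<close>

lemma order_embedding_onto:
  assumes "S \<in> nsets {1..n} m"
  obtains \<psi> where "\<psi> \<in> order_embeddings m n" "\<psi> ` {1..m} = S"
proof -
  have S: "finite S" "card S = m" "S \<subseteq> {1..n}" using assms by (auto simp: nsets_def)
  obtain h where h: "bij_betw h {..<card S} S" "strict_mono_on {..<card S} h"
    using ex_bij_betw_strict_mono_card[OF S(1)] by blast
  \<comment> \<open>\<open>h\<close> enumerates \<open>S\<close> from 0, while vertices are numbered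
    from 1.\<close>
  define \<psi> where "\<psi> = (\<lambda>i\<in>{1..m}. h (i - 1))"
  have "(\<lambda>i. i - 1) ` {1..m} = {..<m}"
    unfolding image_Suc_lessThan[symmetric] image_image by simp
  moreover have "\<psi> ` {1..m} = h ` (\<lambda>i. i - 1) ` {1..m}"
    unfolding image_image by (intro image_cong) (auto simp: \<psi>_def)
  ultimately have im: "\<psi> ` {1..m} = S"
    using h(1) S(2) by (simp only: bij_betw_imp_surj_on)
  have "strict_mono_on {1..m} \<psi>"
    using S(2) by (auto simp: \<psi>_def intro!: strict_mono_onI strict_mono_onD[OF h(2)])
  then have "\<psi> \<in> order_embeddings m n"
    using im S(3) by (auto simp: order_embeddings_def \<psi>_def)
  then show ?thesis using im that by blast
qed

lemma order_embedding_bij: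
  assumes "\<psi> \<in> order_embeddings m n"
  shows "bij_betw \<psi> {1..m} (\<psi> ` {1..m})"
  using assms by (auto simp: order_embeddings_def bij_betw_def intro: strict_mono_on_imp_inj_on)

lemma order_embedding_edge:
  assumes "\<psi> \<in> order_embeddings m n" "e \<in> edges m"
  shows "\<psi> ` e \<in> edges n"
proof -
  have "inj_on \<psi> e"
    using order_embedding_bij[OF assms(1)] assms(2)
    by (auto simp: bij_betw_def edges_def nsets_def intro: inj_on_subset)
  then show ?thesis
    using assms by (auto simp: order_embeddings_def edges_def nsets_def card_image)
qed

lemma order_embedding_compose:
  assumes "\<psi> \<in> order_embeddings m n" "\<phi> \<in> order_embeddings N m"
  shows "(\<lambda>i\<in>{1..N}. \<psi> (\<phi> i)) \<in> order_embeddings N n"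
proof -
  have "\<phi> i \<in> {1..m}" if "i \<in> {1..N}" for i
    using assms(2) that by (auto simp: order_embeddings_def)
  then show ?thesis
    using assms by (auto simp: order_embeddings_def strict_mono_on_def)
qed

text \<open>Vertex sets on which the template allows a forbidden pattern. An increasing map is
  determined by its image, so recording only the image loses nothing and allows counting against
  \<open>n choose N\<close>.\<close>

definition bad_sets :: "nat \<Rightarrow> nat \<Rightarrow> (nat set \<Rightarrow> nat) set \<Rightarrow> (nat set \<Rightarrow> nat set) \<Rightarrow> nat set set" where
  "bad_sets N n \<F> t = {\<phi> ` {1..N} | \<phi>. \<phi> \<in> order_embeddings N n \<and> (\<exists>F\<in>\<F>. \<forall>e\<in>edges N. F e \<in> t (\<phi> ` e))}"

lemma bad_sets_subset: "bad_sets N n \<F> t \<subseteq> nsets {1..n} N"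
proof
  fix X assume "X \<in> bad_sets N n \<F> t"
  then obtain \<phi> where \<phi>: "\<phi> \<in> order_embeddings N n" and X: "X = \<phi> ` {1..N}"
    by (auto simp: bad_sets_def)
  then show "X \<in> nsets {1..n} N"
    using bij_betw_same_card[OF order_embedding_bij[OF \<phi>]]
    by (auto simp: nsets_def order_embeddings_def)
qed

lemma finite_bad_sets: "finite (bad_sets N n \<F> t)"
  by (rule finite_subset[OF bad_sets_subset]) (simp add: finite_imp_finite_nsets)

text \<open>Pull \<open>t\<close> back along the increasing enumeration of \<open>S\<close>. A
  realisation with a forbidden pattern would, composed with the enumeration, exhibit a bad set
  inside \<open>S\<close>, so the pulled-back template competes in \<open>ex k m\<close>.\<close>

lemma Ent_good_subset_le:
  assumes t: "t \<in> templates k n" and S: "S \<in> nsets {1..n} m"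
    and good: "\<And>X. X \<in> bad_sets N n \<F> t \<Longrightarrow> \<not> X \<subseteq> S"
  shows "(\<Sum>e\<in>nsets S 2. log k (card (t e))) \<le> ex k m (Forb k N \<F>)"
proof -
  obtain \<psi> where \<psi>: "\<psi> \<in> order_embeddings m n" and im: "\<psi> ` {1..m} = S"
    using order_embedding_onto[OF S] .
  define t' where "t' = (\<lambda>e\<in>edges m. t (\<psi> ` e))"
  have t': "t' \<in> templates k m"
    using t order_embedding_edge[OF \<psi>] by (auto simp: t'_def templates_def)
  have "bij_betw (\<lambda>e. \<psi> ` e) (edges m) (nsets S 2)"
    using order_embedding_bij[OF \<psi>] unfolding im edges_def by (rule bij_betw_nsets)
  then have "(\<Sum>e\<in>nsets S 2. log k (card (t e))) = Ent k m t'"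
    by (simp add: Ent_def t'_def sum.reindex_bij_betw[symmetric] cong: sum.cong)
  also have "\<dots> \<le> ex k m (Forb k N \<F>)"
  proof (rule Ent_le_ex[OF t'], rule subsetI)
    fix c assume c: "c \<in> realisations k m t'"
    have "pullback N c \<phi> \<notin> \<F>" if \<phi>: "\<phi> \<in> order_embeddings N m" for \<phi>
    proof
      assume F: "pullback N c \<phi> \<in> \<F>"
      define \<theta> where "\<theta> = (\<lambda>i\<in>{1..N}. \<psi> (\<phi> i))"
      have \<theta>: "\<theta> \<in> order_embeddings N n"
        unfolding \<theta>_def by (rule order_embedding_compose[OF \<psi> \<phi>])
      have "pullback N c \<phi> e \<in> t (\<theta> ` e)" if e: "e \<in> edges N" for e
      proof -
        have "\<theta> ` e = \<psi> ` \<phi> ` e"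
          using e by (auto simp: \<theta>_def edges_def nsets_def image_image intro!: image_cong)
        then show ?thesis
          using c order_embedding_edge[OF \<phi> e] e by (auto simp: pullback_def realisations_def t'_def)
      qed
      then have "\<theta> ` {1..N} \<in> bad_sets N n \<F> t"
        using \<theta> F by (auto simp: bad_sets_def)
      moreover have "\<theta> ` {1..N} \<subseteq> S"
        using \<phi> im by (auto simp: \<theta>_def order_embeddings_def)
      ultimately show False using good by blast
    qed
    then show "c \<in> Forb k N \<F> m"
      using c by (auto simp: Forb_def realisations_def)
  qed
  finally show ?thesis .
qed

section \<open>Averaging templates over m-subsets\<close>

lemma card_nsets_superset:
  assumes "finite V" "X \<subseteq> V" "card X \<le> m"
  shows "card {S \<in> nsets V m. X \<subseteq> S} = (card V - card X) choose (m - card X)"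
proof -
  have finX: "finite X" using assms finite_subset by blast
  have "bij_betw (\<lambda>S. S - X) {S \<in> nsets V m. X \<subseteq> S} (nsets (V - X) (m - card X))"
  proof (rule bij_betwI[where g = "\<lambda>S. S \<union> X"])
    show "(\<lambda>S. S \<union> X) \<in> nsets (V - X) (m - card X) \<rightarrow> {S \<in> nsets V m. X \<subseteq> S}"
    proof
      fix S assume S: "S \<in> nsets (V - X) (m - card X)"
      then have "card (S \<union> X) = m"
        using finX assms(3) by (subst card_Un_disjoint) (auto simp: nsets_def)
      then show "S \<union> X \<in> {S \<in> nsets V m. X \<subseteq> S}"
        using S assms finX by (auto simp: nsets_def)
    qed
  qed (use finX in \<open>auto simp: nsets_def card_Diff_subset\<close>)
  then have "card {S \<in> nsets V m. X \<subseteq> S} = card (nsets (V - X) (m - card X))"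
    by (rule bij_betw_same_card)
  then show ?thesis
    using assms finX by (simp add: card_Diff_subset)
qed

lemma Forb_subset: "Forb k N \<F> n \<subseteq> colourings k n"
  by (auto simp: Forb_def)

text \<open>Double counting of pairs of an edge and an \<open>m\<close>-set containing it. An
  \<open>m\<close>-set free of bad sets contributes at most \<open>ex k m P\<close>; any other
  contributes at most its number of edges, as every logarithm is at most 1.\<close>

lemma Ent_averaging:
  fixes k N :: nat and \<F> :: "(nat set \<Rightarrow> nat) set"
  defines "P \<equiv> Forb k N \<F>"
  assumes k: "2 \<le> k" and m: "2 \<le> m" "m \<le> n" and t: "t \<in> templates k n" and ne: "P m \<noteq> {}"
  shows "Ent k n t / (n choose 2) \<le> ex_density k P m
    + card {S \<in> nsets {1..n} m. \<exists>X\<in>bad_sets N n \<F> t. X \<subseteq> S} / (n choose m)"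
proof -
  let ?f = "\<lambda>e. log k (card (t e))"
  let ?V = "nsets {1..n} m"
  let ?H = "{S \<in> ?V. \<exists>X\<in>bad_sets N n \<F> t. X \<subseteq> S}"
  have finV: "finite ?V" by (simp add: finite_imp_finite_nsets)
  obtain t0 where "t0 \<in> templates k m" "Ent k m t0 = ex k m P"
    using ex_attained[of P m k] ne Forb_subset unfolding P_def by metis
  \<comment> \<open>Lets the uniform bound keep the summand \<open>ex k m P\<close> also for the
    exceptional \<open>S\<close>.\<close>
  then have ex0: "0 \<le> ex k m P" using Ent_nonneg[OF k, of t0 m] by simp
  have pos: "0 < real (n choose 2)" "0 < real (m choose 2)" "0 < real (n choose m)"
    using m by auto
  have "real ((n - 2) choose (m - 2)) * Ent k n t
      = (\<Sum>e\<in>edges n. \<Sum>S\<in>{S \<in> ?V. e \<subseteq> S}. ?f e)"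
  proof -
    have "card {S \<in> ?V. e \<subseteq> S} = (n - 2) choose (m - 2)" if "e \<in> edges n" for e
      using card_nsets_superset[of "{1..n}" e m] that m by (simp add: edges_def nsets_def)
    then show ?thesis by (simp add: Ent_def sum_distrib_left)
  qed
  also have "\<dots> = (\<Sum>S\<in>?V. \<Sum>e\<in>{e \<in> edges n. e \<subseteq> S}. ?f e)"
    using finV by (rule sum.swap_restrict[OF finite_edges])
  also have "\<dots> = (\<Sum>S\<in>?V. \<Sum>e\<in>nsets S 2. ?f e)"
    by (intro sum.cong) (auto simp: edges_def nsets_def)
  also have "\<dots> \<le> (\<Sum>S\<in>?V. ex k m P + of_bool (S \<in> ?H) * (m choose 2))"
  proof (intro sum_mono)
    fix S assume S: "S \<in> ?V"
    show "(\<Sum>e\<in>nsets S 2. ?f e) \<le> ex k m P + of_bool (S \<in> ?H) * (m choose 2)"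
    proof (cases "S \<in> ?H")
      case True
      have "(\<Sum>e\<in>nsets S 2. ?f e) \<le> real (card (nsets S 2)) * 1"
        using log_card_template[OF k t] S nsets_mono[of S "{1..n}" 2]
        by (intro sum_bounded_above) (auto simp: edges_def nsets_def)
      moreover have "card S = m" using S by (auto simp: nsets_def)
      ultimately show ?thesis using True ex0 by simp
    next
      case False
      then show ?thesis
        using Ent_good_subset_le[OF t S, of N \<F>] S by (auto simp: P_def)
    qed
  qed
  also have "\<dots> = (n choose m) * ex k m P + real (card ?H) * (m choose 2)"
  proof -
    have "(\<Sum>S\<in>?V. of_bool (S \<in> ?H)) = real (card (?V \<inter> {S. S \<in> ?H}))"
      using finV by (simp only: sum_of_bool_eq)
    also have "?V \<inter> {S. S \<in> ?H} = ?H" by blast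
    finally have "(\<Sum>S\<in>?V. of_bool (S \<in> ?H) * real (m choose 2)) = real (card ?H) * (m choose 2)"
      by (simp only: sum_distrib_right[symmetric])
    then show ?thesis
      unfolding sum.distrib by simp
  qed
  finally have *: "real ((n - 2) choose (m - 2)) * Ent k n t
      \<le> (n choose m) * ex k m P + real (card ?H) * (m choose 2)" .
  have "real (n choose m) * (m choose 2) = (n choose 2) * ((n - 2) choose (m - 2))"
    using choose_mult[OF m] by (metis of_nat_mult)
  then have "real (n choose m) * (m choose 2) * Ent k n t
      = (n choose 2) * (real ((n - 2) choose (m - 2)) * Ent k n t)" by simp
  also have "\<dots> \<le> (n choose 2) * ((n choose m) * ex k m P + real (card ?H) * (m choose 2))"
    using * by (rule mult_left_mono) simp
  finally have main: "real (n choose m) * (m choose 2) * Ent k n t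
      \<le> (n choose 2) * ((n choose m) * ex k m P + real (card ?H) * (m choose 2))" .
  have "x / a \<le> y / c + z / b" if "0 < a" "0 < c" "0 < b" "b * c * x \<le> a * (b * y + z * c)" for a b c x y z :: real
    using that by (simp add: field_simps)
  from this[OF pos main] show ?thesis
    unfolding ex_density_def .
qed

text \<open>Moves the forbidden pattern from \<open>K_N\<close> to the edges inside
  \<open>S\<close>, so that it no longer refers to an embedding.\<close>

lemma bad_set_pattern:
  assumes "S \<in> bad_sets N n \<F> t" "\<F> \<subseteq> colourings k N"
  obtains F where "\<And>e. e \<in> nsets S 2 \<Longrightarrow> F e \<in> t e"
    and "\<And>c. (\<And>e. e \<in> nsets S 2 \<Longrightarrow> c e = F e) \<Longrightarrow> c \<notin> Forb k N \<F> n"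
proof -
  obtain \<phi> F where \<phi>: "\<phi> \<in> order_embeddings N n" and S: "S = \<phi> ` {1..N}"
    and F: "F \<in> \<F>" "\<forall>e\<in>edges N. F e \<in> t (\<phi> ` e)"
    using assms(1) by (auto simp: bad_sets_def)
  have bij: "bij_betw (image \<phi>) (edges N) (nsets S 2)"
    using bij_betw_nsets[OF order_embedding_bij[OF \<phi>], of 2] by (simp add: edges_def S)
  define g where "g = inv_into (edges N) (image \<phi>)"
  have g: "g e \<in> edges N" "\<phi> ` g e = e" if "e \<in> nsets S 2" for e
    using that bij by (auto simp: g_def bij_betw_def inv_into_into f_inv_into_f)
  show ?thesis
  proof (rule that[of "F \<circ> g"])
    show "(F \<circ> g) e \<in> t e" if "e \<in> nsets S 2" for e
      using F(2) g[OF that] by fastforce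
    show "c \<notin> Forb k N \<F> n" if c: "\<And>e. e \<in> nsets S 2 \<Longrightarrow> c e = (F \<circ> g) e" for c
    proof -
      have "pullback N c \<phi> = F"
      proof
        fix e
        show "pullback N c \<phi> e = F e"
        proof (cases "e \<in> edges N")
          case True
          then have "\<phi> ` e \<in> nsets S 2" "g (\<phi> ` e) = e"
            using bij by (auto simp: g_def bij_betw_def)
          then show ?thesis using True c by (simp add: pullback_def)
        next
          \<comment> \<open>Off the edges both sides are \<open>undefined\<close>, as
            \<open>F\<close> is extensional.\<close>
          case False
          then show ?thesis
            using F(1) assms(2) by (auto simp: pullback_def colourings_def PiE_def extensional_def)
        qed
      qed
      then show ?thesis using \<phi> F(1) by (auto simp: Forb_def)
    qed
  qed
qed

text \<open>An extremal template has no bad set: a pattern on a bad set would extend to a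
  realisation outside \<open>Forb k N \<F> n\<close>. Averaging then has no error term.\<close>

lemma ex_density_antimono:
  assumes "2 \<le> k" "2 \<le> m" "m \<le> n" "\<And>n. Forb k N \<F> n \<noteq> {}" "\<F> \<subseteq> colourings k N"
  shows "ex_density k (Forb k N \<F>) n \<le> ex_density k (Forb k N \<F>) m"
proof -
  let ?P = "Forb k N \<F>"
  obtain t where t: "t \<in> templates k n" "realisations k n t \<subseteq> ?P n" "Ent k n t = ex k n ?P"
    using ex_attained[of ?P n k] assms(4) Forb_subset by metis
  have te: "t e \<noteq> {}" "t e \<subseteq> {1..k}" if "e \<in> edges n" for e
    using t(1) that by (auto simp: templates_def)
  have "bad_sets N n \<F> t = {}"
  proof (rule ccontr)
    assume "bad_sets N n \<F> t \<noteq> {}"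
    then obtain S where S: "S \<in> bad_sets N n \<F> t" by blast
    obtain F where F: "\<And>e. e \<in> nsets S 2 \<Longrightarrow> F e \<in> t e"
      and forb: "\<And>c. (\<And>e. e \<in> nsets S 2 \<Longrightarrow> c e = F e) \<Longrightarrow> c \<notin> ?P n"
      using bad_set_pattern[OF S assms(5)] by blast
    have Sn: "nsets S 2 \<subseteq> edges n"
      using S bad_sets_subset[of N n \<F> t] unfolding edges_def by (intro nsets_mono) (auto simp: nsets_def)
    \<comment> \<open>The pattern inside \<open>S\<close>, and an arbitrary permitted colour on
      every other edge.\<close>
    define c where "c = (\<lambda>e\<in>edges n. if e \<in> nsets S 2 then F e else (SOME a. a \<in> t e))"
    have ct: "c e \<in> t e" if "e \<in> edges n" for e
      using that F te[OF that] by (auto simp: c_def some_in_eq)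
    moreover have "c \<in> colourings k n"
      unfolding colourings_def
    proof (rule PiE_I)
      show "c e \<in> {1..k}" if "e \<in> edges n" for e using ct te that by blast
    qed (simp add: c_def)
    ultimately have "c \<in> ?P n"
      using t(2) by (auto simp: realisations_def)
    moreover have "c e = F e" if "e \<in> nsets S 2" for e
      using that Sn by (auto simp: c_def)
    ultimately show False using forb by blast
  qed
  then show ?thesis
    using Ent_averaging[OF assms(1-3) t(1) assms(4)] t(3) by (simp add: ex_density_def)
qed

text \<open>Union bound: each bad set lies in \<open>(n - N) choose (m - N)\<close> of the
  \<open>m\<close>-sets, so at most a fraction \<open>\<kappa> * (m choose N)\<close> of them
  contain one.\<close>

lemma ex_density_bad_sets:
  fixes \<kappa> :: real
  assumes "2 \<le> k" "2 \<le> m" "N \<le> m" "m \<le> n" "t \<in> templates k n" "\<And>n. Forb k N \<F> n \<noteq> {}"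
    and bad: "real (card (bad_sets N n \<F> t)) \<le> \<kappa> * (n choose N)"
  shows "Ent k n t / (n choose 2) \<le> ex_density k (Forb k N \<F>) m + \<kappa> * (m choose N)"
proof -
  let ?X = "bad_sets N n \<F> t"
  have pos: "0 < real (n choose m)" "0 < real (n choose N)" using assms by auto
  have "{S \<in> nsets {1..n} m. \<exists>X\<in>?X. X \<subseteq> S} = (\<Union>X\<in>?X. {S \<in> nsets {1..n} m. X \<subseteq> S})"
    by blast
  then have "card {S \<in> nsets {1..n} m. \<exists>X\<in>?X. X \<subseteq> S} \<le> (\<Sum>X\<in>?X. card {S \<in> nsets {1..n} m. X \<subseteq> S})"
    using card_UN_le[OF finite_bad_sets] by metis
  also have "\<dots> = (\<Sum>X\<in>?X. (n - N) choose (m - N))"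
  proof (intro sum.cong refl)
    fix X assume "X \<in> ?X"
    then have "X \<subseteq> {1..n}" "card X = N" using bad_sets_subset[of N n \<F> t] by (auto simp: nsets_def)
    then show "card {S \<in> nsets {1..n} m. X \<subseteq> S} = (n - N) choose (m - N)"
      using card_nsets_superset[of "{1..n}" X m] assms by simp
  qed
  finally have "real (card {S \<in> nsets {1..n} m. \<exists>X\<in>?X. X \<subseteq> S}) \<le> real (card ?X * ((n - N) choose (m - N)))"
    by (subst of_nat_le_iff) simp
  also have "\<dots> \<le> \<kappa> * ((n choose N) * ((n - N) choose (m - N)))"
    using mult_right_mono[OF bad, of "(n - N) choose (m - N)"] by (simp add: mult_ac)
  also have "real ((n choose N) * ((n - N) choose (m - N))) = (n choose m) * (m choose N)"
    using choose_mult[OF assms(3,4)] by (metis of_nat_mult)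
  finally have "card {S \<in> nsets {1..n} m. \<exists>X\<in>?X. X \<subseteq> S} / (n choose m) \<le> \<kappa> * (m choose N)"
    using pos by (simp add: divide_le_eq mult_ac)
  then show ?thesis
    using Ent_averaging[OF assms(1,2,4,5), of N \<F>] assms(6)[of m] by linarith
qed

subsection \<open>Saturated vertex sets\<close>

definition star :: "nat \<Rightarrow> nat set \<Rightarrow> nat set set" where
  "star n W = {e \<in> edges n. e \<inter> W \<noteq> {}}"

lemma star_mono: "W \<subseteq> W' \<Longrightarrow> star n W \<subseteq> star n W'"
  by (auto simp: star_def)

text \<open>Linear in \<open>n\<close> for \<open>W\<close> of bounded size, so the number of
  possible revealed colour patterns is negligible against the main term.\<close>

lemma card_star_le:
  assumes "finite W"
  shows "card (star n W) \<le> card W * n"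
proof -
  have "star n W \<subseteq> (\<lambda>(w, v). {w, v}) ` (W \<times> {1..n})"
  proof
    fix e assume "e \<in> star n W"
    then have "e \<in> nsets {1..n} 2" and eW: "e \<inter> W \<noteq> {}" by (auto simp: star_def edges_def)
    then obtain x y where xy: "e = {x, y}" "x \<in> {1..n}" "y \<in> {1..n}"
      by (elim nsets2_E)
    show "e \<in> (\<lambda>(w, v). {w, v}) ` (W \<times> {1..n})"
    proof (cases "x \<in> W")
      case True
      then show ?thesis using xy by (intro image_eqI[of _ _ "(x, y)"]) auto
    next
      case False
      then show ?thesis using xy eW by (intro image_eqI[of _ _ "(y, x)"]) auto
    qed
  qed
  then have "card (star n W) \<le> card ((\<lambda>(w, v). {w, v}) ` (W \<times> {1..n}))"
    using assms by (intro card_mono) auto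
  also have "\<dots> \<le> card (W \<times> {1..n})" using assms by (intro card_image_le) auto
  finally show ?thesis by (simp add: card_cartesian_product)
qed

text \<open>The template depends on \<open>c\<close> only through its colours on \<open>T\<close>;
  it is thus determined by what is revealed.\<close>

definition likely :: "nat \<Rightarrow> nat \<Rightarrow> real \<Rightarrow> (nat set \<Rightarrow> nat) set \<Rightarrow> nat set set \<Rightarrow> (nat set \<Rightarrow> nat) \<Rightarrow> nat set \<Rightarrow> nat set" where
  "likely k n \<eta> A T c = (\<lambda>e\<in>edges n. {a \<in> {1..k}. \<eta> \<le> cprob A T e a c})"

lemma sum_cprob:
  assumes "finite A" "c \<in> A" "finite K" "\<And>c. c \<in> A \<Longrightarrow> c e \<in> K"
  shows "(\<Sum>a\<in>K. cprob A T e a c) = 1"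
proof -
  have "(\<Sum>a\<in>K. \<Sum>c'\<in>fiber A T c. of_bool (c' e = a) :: real) = (\<Sum>c'\<in>fiber A T c. \<Sum>a\<in>K. of_bool (c' e = a))"
    by (rule sum.swap)
  also have "\<dots> = (\<Sum>c'\<in>fiber A T c. 1)"
  proof (intro sum.cong refl)
    fix c' assume "c' \<in> fiber A T c"
    then have "c' e \<in> K" using assms(4) fiber_subset by blast
    then show "(\<Sum>a\<in>K. of_bool (c' e = a) :: real) = 1"
      using assms(3) by (simp add: of_bool_def)
  qed
  finally show ?thesis
    using card_fiber_pos[OF assms(1,2), of T]
    by (simp add: cprob_def cavg_def sum_divide_distrib[symmetric] del: sum_of_bool_eq)
qed

text \<open>The \<open>k\<close> conditional probabilities sum to 1, so they cannot all be below
  \<open>\<eta> \<le> 1 / k\<close>.\<close>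

lemma likely_in_templates:
  fixes \<eta> :: real
  assumes A: "A \<subseteq> colourings k n" "c \<in> A" and eta: "\<eta> * k \<le> 1" "0 < k"
  shows "likely k n \<eta> A T c \<in> templates k n"
  unfolding templates_def
proof (rule PiE_I)
  have fin: "finite A" using A(1) finite_colourings finite_subset by blast
  fix e assume e: "e \<in> edges n"
  have "c' e \<in> {1..k}" if "c' \<in> A" for c'
    using subsetD[OF A(1) that] e unfolding colourings_def by (rule PiE_mem)
  then have sum1: "(\<Sum>a\<in>{1..k}. cprob A T e a c) = 1"
    by (intro sum_cprob[OF fin A(2)]) simp_all
  have "\<exists>a\<in>{1..k}. \<eta> \<le> cprob A T e a c"
  proof (rule ccontr)
    assume "\<not> ?thesis"
    then have "(\<Sum>a\<in>{1..k}. cprob A T e a c) < (\<Sum>a\<in>{1..k}. \<eta>)"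
      using eta(2) by (intro sum_strict_mono) (auto simp: not_le)
    with sum1 eta show False by (simp add: mult.commute)
  qed
  then show "likely k n \<eta> A T c e \<in> Pow {1..k} - {{}}"
    using e by (auto simp: likely_def)
qed (simp add: likely_def)

lemma ln_card_fiber_le:
  fixes \<eta> \<rho> :: real
  assumes A: "A \<subseteq> colourings k n" "c \<in> A" and eta: "0 \<le> \<eta>" "\<eta> * k \<le> 1" "2 \<le> k"
    and rho: "0 < \<rho>" "\<rho> \<le> 1"
  shows "ln (card (fiber A T c)) \<le> ln k * Ent k n (likely k n \<eta> A T c)
    + (n choose 2) * (\<rho> * k + k * \<eta> * ln (1 / \<rho>))"
proof -
  let ?t = "likely k n \<eta> A T c"
  have fin: "finite A" using A(1) finite_colourings finite_subset by blast
  have t: "?t \<in> templates k n" using likely_in_templates A eta by auto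
  have B: "fiber A T c \<subseteq> edges n \<rightarrow>\<^sub>E {1..k}" "fiber A T c \<noteq> {}"
    using A fiber_subset[of A T c] self_in_fiber[OF A(2), of T] by (auto simp: colourings_def)
  have rare: "real (card {c' \<in> fiber A T c. c' e = a}) \<le> \<eta> * card (fiber A T c)"
    if "e \<in> edges n" "a \<in> {1..k} - ?t e" for e a
    using that card_fiber_pos[OF fin A(2), of T] by (auto simp: likely_def cprob_eq_card[OF fin] not_le divide_less_eq)
  have "ln (card (fiber A T c)) \<le> (\<Sum>e\<in>edges n. ln (card (?t e)))
      + card (edges n) * (\<rho> * card {1..k} + card {1..k} * \<eta> * ln (1 / \<rho>))"
    by (rule ln_card_le_likely_template[OF finite_edges _ B _ _ rho rare eta(1)])
      (use t in \<open>auto simp: templates_def\<close>)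
  also have "(\<Sum>e\<in>edges n. ln (card (?t e))) = ln k * Ent k n ?t"
    using eta(3) by (simp add: Ent_def log_def sum_distrib_left)
  finally show ?thesis by simp
qed

text \<open>If \<open>S\<close> is bad for \<open>c\<close>, its pattern is missing from
  \<open>A\<close>, so some edge \<open>e\<close> of \<open>S\<close> is sensitive to revealing the
  stars at \<open>S - e\<close>. Summed over \<open>c\<close>, these sensitivities are energy
  increments, indexed by \<open>R = S - e\<close> and \<open>e\<close>.\<close>

lemma sum_card_bad_sets_le:
  fixes k N n :: nat and \<F> :: "(nat set \<Rightarrow> nat) set" and W :: "nat set" and \<eta> :: real
  defines "A \<equiv> Forb k N \<F> n" and "r \<equiv> N choose 2"
  assumes \<F>: "\<F> \<subseteq> colourings k N" and N: "2 \<le> N" and eta: "0 \<le> \<eta>" "\<eta> \<le> 1"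
  shows "\<eta> ^ (2 * r) / r * (\<Sum>c\<in>A. real (card (bad_sets N n \<F> (likely k n \<eta> A (star n W) c))))
    \<le> (\<Sum>R\<in>nsets {1..n} (N - 2). \<Sum>e\<in>edges n. energy A {1..k} (star n (W \<union> R)) e - energy A {1..k} (star n W) e)"
proof -
  let ?T = "star n W" and ?K = "{1..k}" and ?V = "nsets {1..n} N"
  let ?bad = "\<lambda>c. bad_sets N n \<F> (likely k n \<eta> A ?T c)"
  define \<gamma> where "\<gamma> = \<eta> ^ (2 * r) / r"
  define g where "g = (\<lambda>R e. energy A ?K (star n (W \<union> R)) e - energy A ?K ?T e)"
  have fin: "finite A" using Forb_subset finite_colourings finite_subset unfolding A_def by metis
  have finV: "finite ?V" by (simp add: finite_imp_finite_nsets)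
  have g0: "0 \<le> g R e" for R e
    using energy_mono[OF fin star_mono[of W "W \<union> R" n]] by (simp add: g_def)
  have S_edges: "nsets S 2 \<subseteq> edges n" if "S \<in> ?V" for S
    using that unfolding edges_def by (intro nsets_mono) (auto simp: nsets_def)
  have finS: "finite (nsets S 2)" if "S \<in> ?V" for S
    using that by (intro finite_imp_finite_nsets) (auto simp: nsets_def)
  have each: "\<gamma> * (\<Sum>c\<in>A. of_bool (S \<in> ?bad c)) \<le> (\<Sum>e\<in>nsets S 2. g (S - e) e)" if S: "S \<in> ?V" for S
  proof -
    define D where "D = (\<lambda>c. \<Sum>e\<in>nsets S 2. \<Sum>a\<in>?K. (cprob A (star n (W \<union> (S - e))) e a c - cprob A ?T e a c)\<^sup>2)"
    have cardS: "card (nsets S 2) = r" using S unfolding r_def card_nsets by (simp add: nsets_def)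
    have "\<gamma> * of_bool (S \<in> ?bad c) \<le> cavg A ?T D c" if c: "c \<in> A" for c
    proof (cases "S \<in> ?bad c")
      case True
      obtain F where F: "\<And>e. e \<in> nsets S 2 \<Longrightarrow> F e \<in> likely k n \<eta> A ?T c e"
        and forb: "\<And>c. (\<And>e. e \<in> nsets S 2 \<Longrightarrow> c e = F e) \<Longrightarrow> c \<notin> A"
        using bad_set_pattern[OF True \<F>] unfolding A_def by blast
      have lk: "F e \<in> ?K" "\<eta> \<le> cprob A ?T e (F e) c" if "e \<in> nsets S 2" for e
        using F[OF that] S_edges[OF S] that by (auto simp: likely_def subset_iff)
      have "nsets S 2 \<noteq> {}" using cardS N by (metis card.empty r_def zero_less_binomial less_irrefl)
      have "\<eta> ^ (2 * card (nsets S 2)) / card (nsets S 2) \<le> cavg A ?T D c"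
        unfolding D_def
      proof (rule missing_pattern_deviation[OF fin c eta finS[OF S] \<open>nsets S 2 \<noteq> {}\<close> lk(2)])
        fix e assume e: "e \<in> nsets S 2"
        \<comment> \<open>Two distinct pairs are never nested, so every other edge of
          \<open>S\<close> has an endpoint outside \<open>e\<close> and is revealed.\<close>
        have "e' \<inter> (S - e) \<noteq> {}" if "e' \<in> nsets S 2 - {e}" for e'
        proof
          assume "e' \<inter> (S - e) = {}"
          then have "e' \<subseteq> e" using that by (auto simp: nsets_def)
          then have "e' = e" using that e by (intro card_subset_eq) (auto simp: nsets_def)
          with that show False by simp
        qed
        then show "?T \<union> (nsets S 2 - {e}) \<subseteq> star n (W \<union> (S - e))"
          using S_edges[OF S] by (auto simp: star_def Int_Un_distrib)
      next
        show "\<not> (\<exists>c\<in>A. \<forall>e\<in>nsets S 2. c e = F e)" using forb by blast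
      qed (use lk in auto)
      then show ?thesis using True unfolding \<gamma>_def cardS by simp
    next
      case False
      then show ?thesis by (simp add: cavg_def D_def sum_nonneg)
    qed
    then have "\<gamma> * (\<Sum>c\<in>A. of_bool (S \<in> ?bad c)) \<le> (\<Sum>c\<in>A. cavg A ?T D c)"
      unfolding sum_distrib_left by (rule sum_mono)
    also have "\<dots> = (\<Sum>c\<in>A. D c)" by (rule sum_cavg_1[OF fin])
    also have "\<dots> = (\<Sum>e\<in>nsets S 2. \<Sum>c\<in>A. \<Sum>a\<in>?K. (cprob A (star n (W \<union> (S - e))) e a c - cprob A ?T e a c)\<^sup>2)"
      unfolding D_def by (rule sum.swap)
    also have "\<dots> = (\<Sum>e\<in>nsets S 2. g (S - e) e)"
      unfolding g_def by (intro sum.cong refl energy_increment[symmetric] fin star_mono) auto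
    finally show ?thesis .
  qed
  have "(\<Sum>c\<in>A. real (card (?bad c))) = (\<Sum>c\<in>A. \<Sum>S\<in>?V. of_bool (S \<in> ?bad c))"
  proof (intro sum.cong refl)
    fix c
    have "(\<Sum>S\<in>?V. of_bool (S \<in> ?bad c)) = real (card (?V \<inter> {S. S \<in> ?bad c}))"
      using finV by (simp only: sum_of_bool_eq)
    also have "?V \<inter> {S. S \<in> ?bad c} = ?bad c" using bad_sets_subset by blast
    finally show "real (card (?bad c)) = (\<Sum>S\<in>?V. of_bool (S \<in> ?bad c))" ..
  qed
  also have "\<dots> = (\<Sum>S\<in>?V. \<Sum>c\<in>A. of_bool (S \<in> ?bad c))" by (rule sum.swap)
  finally have "\<gamma> * (\<Sum>c\<in>A. real (card (?bad c))) = (\<Sum>S\<in>?V. \<gamma> * (\<Sum>c\<in>A. of_bool (S \<in> ?bad c)))"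
    by (simp only: sum_distrib_left)
  also have "\<dots> \<le> (\<Sum>S\<in>?V. \<Sum>e\<in>nsets S 2. g (S - e) e)"
    by (intro sum_mono each)
  also have "\<dots> = (\<Sum>(S, e)\<in>Sigma ?V (\<lambda>S. nsets S 2). g (S - e) e)"
    using finV finS by (intro sum.Sigma) auto
  \<comment> \<open>\<open>S\<close> is recovered from the pair as the union of \<open>S - e\<close>
    and \<open>e\<close>.\<close>
  also have "\<dots> = (\<Sum>(R, e)\<in>(\<lambda>(S, e). (S - e, e)) ` Sigma ?V (\<lambda>S. nsets S 2). g R e)"
  proof (subst sum.reindex)
    show "inj_on (\<lambda>(S, e). (S - e, e)) (Sigma ?V (\<lambda>S. nsets S 2))"
      by (auto simp: inj_on_def nsets_def)
  qed (auto intro!: sum.cong)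
  \<comment> \<open>Pairs in which \<open>R\<close> meets \<open>e\<close> are added too; their
    increments are nonnegative.\<close>
  also have "\<dots> \<le> (\<Sum>(R, e)\<in>nsets {1..n} (N - 2) \<times> edges n. g R e)"
  proof (intro sum_mono2)
    show "(\<lambda>(S, e). (S - e, e)) ` Sigma ?V (\<lambda>S. nsets S 2) \<subseteq> nsets {1..n} (N - 2) \<times> edges n"
      using S_edges by (auto simp: nsets_def card_Diff_subset)
  qed (use g0 in \<open>auto simp: finite_imp_finite_nsets\<close>)
  also have "\<dots> = (\<Sum>R\<in>nsets {1..n} (N - 2). \<Sum>e\<in>edges n. g R e)"
    by (rule sum.cartesian_product[symmetric])
  finally show ?thesis by (simp add: \<gamma>_def g_def)
qed

section \<open>The upper bound for large n\<close>

lemma binomial_product_le: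
  assumes "2 \<le> N" "N \<le> n"
  shows "real (n choose (N - 2)) * real (n choose 2) \<le> real N ^ N * (n choose N)"
proof -
  have "(n choose (N - 2)) * (n choose 2) \<le> n ^ (N - 2) * n ^ 2"
    using assms by (intro mult_mono binomial_le_pow) auto
  also have "\<dots> = n ^ N" using assms by (metis le_add_diff_inverse2 power_add)
  finally have "real (n choose (N - 2)) * real (n choose 2) \<le> real n ^ N"
    by (metis of_nat_le_iff of_nat_mult of_nat_power)
  also have "\<dots> = real N ^ N * (real n / real N) ^ N"
    using assms by (simp add: power_divide)
  also have "\<dots> \<le> real N ^ N * (n choose N)"
    using assms by (intro mult_left_mono binomial_ge_n_over_k_pow_k) auto
  finally show ?thesis .
qed

text \<open>Here \<open>\<kappa>\<close> is the tolerated density of bad sets,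
  \<open>\<delta>\<close> the normalised energy gain below which \<open>W\<close> counts as
  saturated, and \<open>L * N\<close> bounds the size of \<open>W\<close>. The term
  \<open>ln 2\<close> pays for keeping only half of the colourings, and \<open>L * N * n\<close> for
  the revealed edges.\<close>

lemma ln_card_Forb_le:
  fixes k N n :: nat and \<F> :: "(nat set \<Rightarrow> nat) set" and \<eta> \<rho> \<kappa> :: real
  defines "P \<equiv> Forb k N \<F>" and "r \<equiv> N choose 2"
  assumes \<F>: "\<F> \<subseteq> colourings k N" and ne: "\<And>n. P n \<noteq> {}" and k: "2 \<le> k" and N: "2 \<le> N"
    and eta: "0 < \<eta>" "\<eta> * k \<le> 1" and rho: "0 < \<rho>" "\<rho> \<le> 1"
    and m: "2 \<le> m" "N \<le> m" "m \<le> n" and kappa: "0 < \<kappa>"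
    and \<delta>: "\<delta> = \<kappa> * (\<eta> ^ (2 * r) / r) / (2 * real N ^ N)" and L: "k \<le> real L * \<delta>"
  shows "ln (card (P n)) \<le> ln 2 + real (L * N * n) * ln k
    + (n choose 2) * ((ex_density k P m + \<kappa> * (m choose N)) * ln k + (\<rho> * k + k * \<eta> * ln (1 / \<rho>)))"
proof -
  define A where "A = P n"
  define M where "M = real (n choose 2)"
  define \<gamma> where "\<gamma> = \<eta> ^ (2 * r) / r"
  define \<Phi> where "\<Phi> = (\<lambda>W. \<Sum>e\<in>edges n. energy A {1..k} (star n W) e)"
  \<comment> \<open>\<open>\<Phi>\<close> sums over all edges and colourings, so the gain
    \<open>\<delta>\<close> is scaled by both counts.\<close>
  define d where "d = \<delta> * M * card A"
  have AC: "A \<subseteq> colourings k n" using Forb_subset by (simp add: A_def P_def)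
  have fin: "finite A" using AC finite_colourings finite_subset by blast
  have a: "0 < real (card A)" using fin ne[of n] by (simp add: A_def card_gt_0_iff)
  have M: "0 < M" using m by (simp add: M_def)
  have r: "0 < real r" using N by (simp add: r_def)
  have \<gamma>: "0 < \<gamma>" using eta r by (simp add: \<gamma>_def)
  have \<delta>0: "0 < \<delta>" using kappa eta r N by (simp add: \<delta>)
  have lnk: "0 < ln (real k)" using k by simp
  have nN: "0 < real (n choose N)" using m by simp
  have eta1: "\<eta> \<le> 1"
    using eta k mult_left_mono[of 1 "real k" \<eta>] by linarith
  have \<Phi>0: "0 \<le> \<Phi> W" for W
    by (simp add: \<Phi>_def energy_nonneg sum_nonneg)
  have \<Phi>b: "\<Phi> W \<le> M * (card A * k)" for W
    using sum_bounded_above[of "edges n" "\<lambda>e. energy A {1..k} (star n W) e" "real (card A) * k"]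
      energy_le[OF fin, of "{1..k}"] by (simp add: \<Phi>_def M_def)
  have "M * (card A * k) \<le> real L * d"
    using mult_left_mono[OF L, of "M * card A"] M a by (simp add: d_def mult_ac)
  then obtain W where W: "finite W" "card W \<le> L * N"
    and sat: "\<And>R. finite R \<Longrightarrow> card R \<le> N \<Longrightarrow> \<Phi> (W \<union> R) \<le> \<Phi> W + d"
    using ex_saturated_subset[of \<Phi>, OF \<Phi>0 \<Phi>b, of d L N] \<delta>0 M a by (auto simp: d_def)
  define T where "T = star n W"
  define bad where "bad = (\<lambda>c. real (card (bad_sets N n \<F> (likely k n \<eta> A T c))))"
  have "\<gamma> * (\<Sum>c\<in>A. bad c) \<le> (\<Sum>R\<in>nsets {1..n} (N - 2). \<Phi> (W \<union> R) - \<Phi> W)"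
    using sum_card_bad_sets_le[OF \<F> N less_imp_le[OF eta(1)] eta1, of n W]
    by (simp add: \<gamma>_def bad_def \<Phi>_def sum_subtractf A_def P_def r_def T_def)
  also have "\<dots> \<le> (\<Sum>R\<in>nsets {1..n} (N - 2). d)"
  proof (intro sum_mono)
    fix R assume "R \<in> nsets {1..n} (N - 2)"
    then show "\<Phi> (W \<union> R) - \<Phi> W \<le> d" using sat[of R] by (auto simp: nsets_def)
  qed
  also have "\<dots> = \<delta> * card A * ((n choose (N - 2)) * M)"
    by (simp add: d_def mult_ac)
  also have "\<dots> \<le> \<delta> * card A * (real N ^ N * (n choose N))"
    unfolding M_def using \<delta>0 m by (intro mult_left_mono binomial_product_le N) auto
  \<comment> \<open>The value of \<open>\<delta>\<close> is chosen for this: it leaves a mean of at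
    most half the tolerated number of bad sets.\<close>
  also have "\<dots> = \<gamma> * (\<kappa> / 2 * (n choose N) * card A)"
    using N by (simp add: \<delta> \<gamma>_def)
  finally have bad_sum: "(\<Sum>c\<in>A. bad c) \<le> \<kappa> / 2 * (n choose N) * card A"
    using \<gamma> by (simp only: mult_le_cancel_left_pos)
  define G where "G = {c \<in> A. bad c \<le> \<kappa> * (n choose N)}"
  have finG: "finite G" using fin by (simp add: G_def)
  \<comment> \<open>Markov's inequality for the number of bad sets.\<close>
  have "card A \<le> 2 * real (card G)"
  proof -
    have "(card A - real (card G)) * (\<kappa> * (n choose N)) = (\<Sum>c\<in>A - G. \<kappa> * (n choose N))"
      using fin finG by (simp add: card_Diff_subset G_def of_nat_diff card_mono)
    also have "\<dots> \<le> (\<Sum>c\<in>A - G. bad c)" by (intro sum_mono) (auto simp: G_def)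
    also have "\<dots> \<le> (\<Sum>c\<in>A. bad c)" using fin by (intro sum_mono2) (auto simp: bad_def)
    finally have "(card A - real (card G)) * (\<kappa> * (n choose N)) \<le> card A / 2 * (\<kappa> * (n choose N))"
      using bad_sum by (simp add: mult_ac)
    then have "card A - real (card G) \<le> card A / 2"
      using kappa nN by (simp only: mult_le_cancel_right_pos[OF mult_pos_pos])
    then show ?thesis by simp
  qed
  define u where "u = M * ((ex_density k P m + \<kappa> * (m choose N)) * ln k + (\<rho> * k + k * \<eta> * ln (1 / \<rho>)))"
  have fib: "real (card (fiber A T c)) \<le> exp u" if c: "c \<in> G" for c
  proof -
    let ?t = "likely k n \<eta> A T c"
    have cA: "c \<in> A" using c by (simp add: G_def)
    have "?t \<in> templates k n" using AC cA eta k by (intro likely_in_templates) auto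
    then have "Ent k n ?t / (n choose 2) \<le> ex_density k P m + \<kappa> * (m choose N)"
      unfolding P_def using c ne m k
      by (intro ex_density_bad_sets) (auto simp: G_def bad_def P_def)
    then have "ln k * Ent k n ?t \<le> ln k * (M * (ex_density k P m + \<kappa> * (m choose N)))"
      using M lnk by (simp add: M_def divide_le_eq mult.commute)
    moreover have "ln (card (fiber A T c)) \<le> ln k * Ent k n ?t + M * (\<rho> * k + k * \<eta> * ln (1 / \<rho>))"
      unfolding M_def using AC cA eta k rho by (intro ln_card_fiber_le) auto
    ultimately have "ln (card (fiber A T c)) \<le> u"
      by (simp add: u_def algebra_simps)
    then show ?thesis
      using card_fiber_pos[OF fin cA, of T] by (metis exp_le_cancel_iff exp_ln of_nat_0_less_iff)
  qed
  have finT: "finite T" by (rule finite_subset[OF _ finite_edges[of n]]) (auto simp: T_def star_def)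
  have TW: "card T \<le> L * N * n"
    using card_star_le[OF W(1), of n] W(2) unfolding T_def by (meson le_trans mult_le_mono1)
  \<comment> \<open>Each colour pattern on \<open>T\<close> selects from \<open>G\<close> a part of
    a single fiber, and \<open>fib\<close> bounds every fiber that meets \<open>G\<close>.\<close>
  have "real (card G) \<le> real k ^ card T * exp u"
  proof -
    let ?X = "T \<rightarrow>\<^sub>E {1..k}"
    have "G \<subseteq> (\<Union>x\<in>?X. {c \<in> G. restrict c T = x})"
    proof
      fix c assume c: "c \<in> G"
      then have "c \<in> colourings k n" using AC by (auto simp: G_def)
      then have "restrict c T \<in> ?X"
        by (auto simp: colourings_def T_def star_def)
      with c show "c \<in> (\<Union>x\<in>?X. {c \<in> G. restrict c T = x})" by blast
    qed
    then have "card G \<le> card (\<Union>x\<in>?X. {c \<in> G. restrict c T = x})"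
      using finT finG by (intro card_mono) (auto simp: finite_PiE)
    also have "\<dots> \<le> (\<Sum>x\<in>?X. card {c \<in> G. restrict c T = x})"
      using finT by (intro card_UN_le finite_PiE) auto
    finally have "real (card G) \<le> (\<Sum>x\<in>?X. real (card {c \<in> G. restrict c T = x}))"
      by (simp only: of_nat_le_iff flip: of_nat_sum)
    also have "\<dots> \<le> (\<Sum>x\<in>?X. exp u)"
    proof (intro sum_mono)
      fix x
      show "real (card {c \<in> G. restrict c T = x}) \<le> exp u"
      proof (cases "{c \<in> G. restrict c T = x} = {}")
        case False
        then obtain c where c: "c \<in> G" "restrict c T = x" by blast
        have "{c \<in> G. restrict c T = x} \<subseteq> fiber A T c"
          using c(2) by (auto simp: fiber_def G_def restrict_def fun_eq_iff split: if_splits)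
        then have "card {c \<in> G. restrict c T = x} \<le> card (fiber A T c)"
          using finite_fiber[OF fin] by (rule card_mono[rotated])
        then show ?thesis using fib[OF c(1)] by linarith
      next
        case True
        then show ?thesis by (simp only: card.empty) simp
      qed
    qed
    also have "\<dots> = real k ^ card T * exp u"
      using finT by (simp add: card_PiE)
    finally show ?thesis .
  qed
  with \<open>card A \<le> 2 * real (card G)\<close> have "card A \<le> 2 * (real k ^ card T * exp u)" by simp
  then have "ln (card A) \<le> ln (2 * (real k ^ card T * exp u))"
    using a by (subst ln_le_cancel_iff) auto
  also have "\<dots> = ln 2 + (real (card T) * ln k + u)"
    using k by (simp add: ln_mult_pos ln_realpow)
  also have "\<dots> \<le> ln 2 + (real (L * N * n) * ln k + u)"
    using TW lnk by (intro add_left_mono add_right_mono mult_right_mono) (simp_all only: of_nat_le_iff less_imp_le)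
  finally show ?thesis
    by (simp add: A_def u_def M_def)
qed

section \<open>Degenerate parameters, the limit and the choice of constants\<close>

lemma pullback_id:
  assumes "c \<in> colourings k N"
  shows "pullback N c (\<lambda>i\<in>{1..N}. i) = c"
proof
  fix e
  show "pullback N c (\<lambda>i\<in>{1..N}. i) e = c e"
  proof (cases "e \<in> edges N")
    case True
    then have "(\<lambda>i\<in>{1..N}. i) ` e = e"
      by (force simp: edges_def nsets_def image_iff subset_iff)
    then show ?thesis using True by (simp add: pullback_def)
  next
    case False
    then show ?thesis
      using assms by (auto simp: pullback_def colourings_def PiE_def extensional_def)
  qed
qed

text \<open>Otherwise \<open>K_N\<close> has at most one colouring; as \<open>\<F>\<close> is
  nonempty it contains it, and nothing is left in \<open>Forb k N \<F> N\<close>.\<close>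

lemma Forb_nontrivial:
  assumes "\<F> \<subseteq> colourings k N" "\<F> \<noteq> {}" "\<And>n. Forb k N \<F> n \<noteq> {}"
  shows "2 \<le> k \<and> 2 \<le> N"
proof (rule ccontr)
  assume small: "\<not> ?thesis"
  have id: "(\<lambda>i\<in>{1..N}. i) \<in> order_embeddings N N"
    by (auto simp: order_embeddings_def strict_mono_on_def)
  obtain F c where F: "F \<in> \<F>" and c: "c \<in> Forb k N \<F> N" using assms by blast
  then have cc: "c \<in> colourings k N" and Fc: "F \<in> colourings k N" using Forb_subset assms(1) by blast+
  have "c = F"
  proof (rule extensionalityI[of _ "edges N"])
    fix e assume e: "e \<in> edges N"
    then have "card e \<le> card {1..N}" "card e = 2"
      unfolding edges_def nsets_def by (blast intro: card_mono finite_atLeastAtMost)+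
    then have "k < 2" using small by simp
    moreover have "c e \<in> {1..k}" "F e \<in> {1..k}" using cc Fc e by (auto simp: colourings_def)
    ultimately show "c e = F e" by simp
  qed (use cc Fc in \<open>auto simp: colourings_def PiE_def\<close>)
  then show False
    using c F id pullback_id[OF cc] by (auto simp: Forb_def)
qed

theorem theorem2p12:
  fixes k N :: nat
    and \<F> :: "(nat set \<Rightarrow> nat) set"
    and P :: "nat \<Rightarrow> (nat set \<Rightarrow> nat) set"
  assumes "\<F> \<subseteq> colourings k N"
    and "\<F> \<noteq> {}"
    and "P = Forb k N \<F>"
    and "\<And>n. P n \<noteq> {}"
  shows "convergent (ex_density k P) \<and>
    (\<forall>\<epsilon>>0. \<exists>n\<^sub>0. \<forall>n\<ge>n\<^sub>0.
       real k powr (entropy_density k P * real (n choose 2)) \<le> real (card (P n)) \<and>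
       real (card (P n)) \<le> real k powr ((entropy_density k P + \<epsilon>) * real (n choose 2)))"
proof -
  have k: "2 \<le> k" and N: "2 \<le> N" using Forb_nontrivial[OF assms(1,2)] assms(3,4) by auto
  have lnk: "0 < ln (real k)" using k by simp
  have PC: "P n \<subseteq> colourings k n" for n using Forb_subset assms(3) by simp
  have anti: "ex_density k P n \<le> ex_density k P m" if "2 \<le> m" "m \<le> n" for m n
    using ex_density_antimono[OF k that, of N \<F>] assms by simp
  have dens0: "0 \<le> ex_density k P n" for n
  proof -
    obtain t where "t \<in> templates k n" "Ent k n t = ex k n P"
      using ex_attained[of P n k] assms(4) PC by metis
    then show ?thesis using Ent_nonneg[OF k, of t n] by (simp add: ex_density_def)
  qed
  \<comment> \<open>Shifted by 2 because for \<open>n < 2\<close> the denominator is 0 and the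
    quotient is 0 by convention, which breaks monotonicity.\<close>
  have "decseq (\<lambda>n. ex_density k P (n + 2))"
    by (intro decseq_SucI anti) auto
  then obtain l where l: "(\<lambda>n. ex_density k P (n + 2)) \<longlonglongrightarrow> l" and l_le: "\<And>n. l \<le> ex_density k P (n + 2)"
    using decseq_convergent[of "\<lambda>n. ex_density k P (n + 2)" 0] dens0 by auto
  have lim: "ex_density k P \<longlonglongrightarrow> l" using l by (rule LIMSEQ_offset)
  have ed: "entropy_density k P = l"
    unfolding entropy_density_def using lim by (rule limI)
  have le: "l \<le> ex_density k P n" if "2 \<le> n" for n
    using l_le[of "n - 2"] le_add_diff_inverse2[OF that] by simp
  \<comment> \<open>The limit is approached from above, so the realisations of one extremal template
    suffice, with no error term.\<close>
  have lower: "real k powr (l * real (n choose 2)) \<le> card (P n)" if n: "2 \<le> n" for n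
  proof -
    obtain t where t: "t \<in> templates k n" "realisations k n t \<subseteq> P n" "Ent k n t = ex k n P"
      using ex_attained[of P n k] assms(4) PC by metis
    have "0 < real (n choose 2)" using n by simp
    then have "l * real (n choose 2) \<le> Ent k n t"
      using le[OF n] t(3) by (simp add: ex_density_def le_divide_eq)
    then have "real k powr (l * real (n choose 2)) \<le> card (realisations k n t)"
      using k card_realisations[OF k t(1)] by simp
    also have "\<dots> \<le> card (P n)"
      using t(2) PC[of n] finite_colourings finite_subset by (metis card_mono of_nat_mono)
    finally show ?thesis .
  qed
  have upper: "\<exists>n\<^sub>0. \<forall>n\<ge>n\<^sub>0. real (card (P n)) \<le> real k powr ((l + \<epsilon>) * real (n choose 2))" if e: "0 < \<epsilon>" for \<epsilon>
  proof -
    \<comment> \<open>Error budget, in units of \<open>ln k\<close> per edge: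
      \<open>\<epsilon> / 4\<close> each for the density at \<open>m\<close>, for bad sets, for the
      two Gibbs terms (\<open>q\<close> each), and for the terms linear in \<open>n\<close>.\<close>
    define q where "q = \<epsilon> / 8 * ln k"
    have q: "0 < q" using e lnk by (simp add: q_def)
    define \<rho> where "\<rho> = min 1 (q / k)"
    have rho: "0 < \<rho>" "\<rho> \<le> 1" "\<rho> * k \<le> q"
      using q k by (auto simp: \<rho>_def min_def field_simps)
    have lnr: "0 \<le> ln (1 / \<rho>)" using rho by simp
    \<comment> \<open>Chosen after \<open>\<rho>\<close>, since the cost of unlikely colours
      involves \<open>ln (1 / \<rho>)\<close>; the added 1 keeps the denominator positive when
      \<open>\<rho> = 1\<close>.\<close>
    define \<eta> where "\<eta> = min (1 / k) (q / (k * (ln (1 / \<rho>) + 1)))"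
    have pos: "0 < k * (ln (1 / \<rho>) + 1)" using k lnr by (intro mult_pos_pos) auto
    have eta: "0 < \<eta>" "\<eta> * k \<le> 1"
      using k q pos by (auto simp: \<eta>_def min_def field_simps)
    have "k * \<eta> * ln (1 / \<rho>) \<le> \<eta> * (k * (ln (1 / \<rho>) + 1))"
      using eta by (simp add: algebra_simps)
    also have "\<dots> \<le> q / (k * (ln (1 / \<rho>) + 1)) * (k * (ln (1 / \<rho>) + 1))"
      using pos by (intro mult_right_mono) (auto simp: \<eta>_def)
    also have "\<dots> = q" using pos by (metis less_irrefl nonzero_eq_divide_eq)
    finally have eta3: "k * \<eta> * ln (1 / \<rho>) \<le> q" .
    have "\<forall>\<^sub>F n in sequentially. ex_density k P n < l + \<epsilon> / 4"
      using e by (intro order_tendstoD(2)[OF lim]) simp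
    then obtain m0 where m0: "\<And>n. m0 \<le> n \<Longrightarrow> ex_density k P n < l + \<epsilon> / 4"
      by (auto simp: eventually_sequentially)
    define m where "m = max m0 N"
    have m: "2 \<le> m" "N \<le> m" "ex_density k P m \<le> l + \<epsilon> / 4"
      using m0[of m] N by (auto simp: m_def)
    define \<kappa> where "\<kappa> = \<epsilon> / (4 * (m choose N))"
    have mN: "0 < real (m choose N)" using m by simp
    have kappa: "0 < \<kappa>" "\<kappa> * (m choose N) = \<epsilon> / 4"
      using e mN by (auto simp: \<kappa>_def)
    define r where "r = N choose 2"
    define \<delta> where "\<delta> = \<kappa> * (\<eta> ^ (2 * r) / r) / (2 * real N ^ N)"
    have "0 < real r" using N by (simp add: r_def)
    then have "0 < \<delta>" using kappa eta N by (simp add: \<delta>_def)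
    then obtain L :: nat where L: "k \<le> real L * \<delta>"
      using reals_Archimedean3[of \<delta>] by (meson less_imp_le)
    have bound: "ln (card (P n)) \<le> ln 2 + real (L * N * n) * ln k + (n choose 2) * ((l + 3 / 4 * \<epsilon>) * ln k)"
      if n: "m \<le> n" for n
    proof -
      have "ln (card (P n)) \<le> ln 2 + real (L * N * n) * ln k
        + (n choose 2) * ((ex_density k P m + \<kappa> * (m choose N)) * ln k + (\<rho> * k + k * \<eta> * ln (1 / \<rho>)))"
        using ln_card_Forb_le[OF assms(1) _ k N eta rho(1,2) m(1,2) n kappa(1) \<delta>_def[unfolded r_def] L]
          assms(3,4) by simp
      also have "(ex_density k P m + \<kappa> * (m choose N)) * ln k + (\<rho> * k + k * \<eta> * ln (1 / \<rho>))
          \<le> (l + \<epsilon> / 4 + \<epsilon> / 4) * ln k + (q + q)"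
        using m(3) kappa(2) rho(3) eta3 lnk by (intro add_mono mult_right_mono) auto
      also have "\<dots> = (l + 3 / 4 * \<epsilon>) * ln k"
        by (simp add: q_def algebra_simps)
      finally show ?thesis by (simp add: mult_left_mono)
    qed
    \<comment> \<open>For \<open>n \<ge> C\<close> the linear terms, at most
      \<open>n * (1 + L * N * ln k)\<close>, fit into the last quarter of the budget, because
      \<open>n choose 2\<close> is \<open>n * (n - 1) / 2\<close>.\<close>
    define C where "C = 8 * (1 + real (L * N) * ln k) / (\<epsilon> * ln k) + 1"
    obtain n1 :: nat where n1: "C \<le> real n1" using real_arch_simple by blast
    show ?thesis
    proof (intro exI[of _ "max m n1"] allI impI)
      fix n assume n: "max m n1 \<le> n"
      then have n2: "2 \<le> n" using m by simp
      have choose: "real (n choose 2) = real n * (real n - 1) / 2"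
        using n2 by (simp add: choose_two real_of_nat_div of_nat_diff)
      have "8 * (1 + real (L * N) * ln k) / (\<epsilon> * ln k) \<le> real n - 1"
        using n1 n by (simp add: C_def)
      then have "1 + real (L * N) * ln k \<le> \<epsilon> / 8 * ln k * (real n - 1)"
        using e lnk by (simp add: field_simps)
      then have "real n * (1 + real (L * N) * ln k) \<le> real n * (\<epsilon> / 8 * ln k * (real n - 1))"
        by (intro mult_left_mono) auto
      moreover have "ln 2 \<le> real n" using n2 ln_le_minus_one[of "2 :: real"] by simp
      ultimately have "ln 2 + real (L * N * n) * ln k \<le> (n choose 2) * (\<epsilon> / 4 * ln k)"
        by (simp add: choose algebra_simps)
      then have "ln (card (P n)) \<le> (l + \<epsilon>) * real (n choose 2) * ln k"
        using bound[of n] n by (simp add: algebra_simps)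
      moreover have "0 < card (P n)"
        using assms(4)[of n] PC[of n] finite_colourings finite_subset by (metis card_gt_0_iff)
      ultimately have "real (card (P n)) \<le> exp ((l + \<epsilon>) * real (n choose 2) * ln k)"
        by (metis exp_le_cancel_iff exp_ln of_nat_0_less_iff)
      then show "real (card (P n)) \<le> real k powr ((l + \<epsilon>) * real (n choose 2))"
        using k by (simp add: powr_def)
    qed
  qed
  show ?thesis
  proof (intro conjI allI impI)
    show "convergent (ex_density k P)" using lim by (auto simp: convergent_def)
    fix \<epsilon> :: real assume "0 < \<epsilon>"
    then obtain n0 where "\<forall>n\<ge>n0. real (card (P n)) \<le> real k powr ((l + \<epsilon>) * real (n choose 2))"
      using upper by blast
    then show "\<exists>n\<^sub>0. \<forall>n\<ge>n\<^sub>0.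
       real k powr (entropy_density k P * real (n choose 2)) \<le> real (card (P n)) \<and>
       real (card (P n)) \<le> real k powr ((entropy_density k P + \<epsilon>) * real (n choose 2))"
      unfolding ed using lower by (intro exI[of _ "max n0 2"]) auto
  qed
qed

end
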